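(* Let $\mu,\nu\in\mathcal P_1(\mathbb R)$ be such that $\mu\le_{cx}\nu$ and $\mu\neq\nu$, and let $\pi\in\Pi(\mu,\nu)$ satisfy the barycentre dispersion assumption $$\forall a\in\mathbb R,\quad\int_{\mathbb R}\mathbf 1_{[a,+\infty)}(x)\Big(x-\int_{\mathbb R}y\,\pi_x(dy)\Big)\,\mu(dx)\le0.$$ Let $(m_u)_{u\in(0,1)}$ be the probability kernel constructed from $\pi$ in the context and let $M(dx,dy)=\int_0^1\delta_{F_\mu^{-1}(u)}(dx)\,m_u(dy)\,du$. Then $M$ is a martingale rearrangement coupling of $\pi$; more precisely, $M\in\Pi^{\mathrm M}(\mu,\nu)$ and $$\inf_{M'\in\Pi^{\mathrm M}(\mu,\nu)}\mathcal{AW}_1(\pi,M')=\mathcal{AW}_1(\pi,M)=\int_{\mathbb R}\mathcal W_1(\pi_x,M_x)\,\mu(dx)=\int_{\mathbb R}\left|\int_{\mathbb R}y\,\pi_x(dy)-x\right|\,\mu(dx).$$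
   Context: **General notation.** $\mathcal P_\rho(\mathbb R)$ is the set of probability measures on $\mathbb R$ with finite moment of order $\rho\ge1$. $\Pi(\mu,\nu)$ is the set of couplings of $\mu$ and $\nu$; for $\pi\in\Pi(\mu,\nu)$, $(\pi_x)_{x\in\mathbb R}$ denotes its disintegration $\pi(dx,dy)=\mu(dx)\,\pi_x(dy)$ (a version with $\pi_x\in\mathcal P_1(\mathbb R)$ for all $x$ is used). $\Pi^{\mathrm M}(\mu,\nu)$ is the set of $M\in\Pi(\mu,\nu)$ with $\int_{\mathbb R}y\,M_x(dy)=x$ for $\mu$-a.e. $x$. $\mu\le_{cx}\nu$ (convex order) means $\int f\,d\mu\le\int f\,d\nu$ for all convex $f:\mathbb R\to\mathbb R$. $F_\eta(x)=\eta((-\infty,x])$, $F_\eta^{-1}(u)=\inf\{x\in\mathbb R: F_\eta(x)\ge u\}$ for $u\in(0,1)$. $\eta\le_{st}\eta'$ (stochastic order) means $F_\eta^{-1}(u)\le F_{\eta'}^{-1}(u)$ for all $u\in(0,1)$. $\mathcal W_\rho$ is the Wasserstein distance of order $\rho$ on $\mathcal P_\rho(\mathbb R)$ for the cost $|x-y|^\rho$. For $\pi\in\Pi(\mu,\nu)$, $\pi'\in\Pi(\mu',\nu')$, $$\mathcal{AW}_\rho(\pi,\pi')=\inf_{\chi\in\Pi(\mu,\mu')}\left(\int_{\mathbb R\times\mathbb R}\left(|x-x'|^\rho+\mathcal W_\rho^\rho(\pi_x,\pi'_{x'})\right)\chi(dx,dx')\right)^{1/\rho}.$$ $M\in\Pi^{\mathrm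 M}(\mu,\nu)$ is a martingale rearrangement coupling of $\pi\in\Pi(\mu,\nu)$ if $\mathcal{AW}_1(\pi,M)=\inf_{M'\in\Pi^{\mathrm M}(\mu,\nu)}\mathcal{AW}_1(\pi,M')$. **The maps $\beta,\widetilde\beta$.** Let $\mathfrak B$ be the set of quadruples $(y,\widetilde y,\eta,\widetilde\eta)\in\mathbb R\times\mathbb R\times\mathcal P_1(\mathbb R)\times\mathcal P_1(\mathbb R)$ such that the means $x,\widetilde x$ of $\eta,\widetilde\eta$ satisfy $x<y\le\widetilde y<\widetilde x$, with the trace of the product $\sigma$-algebra ($\mathcal P_1(\mathbb R)$ carrying the Borel $\sigma$-algebra of weak convergence). Fix measurable maps $\beta,\widetilde\beta:\mathfrak B\to\mathcal P_1(\mathbb R)$ (such maps exist) such that for all $(y,\widetilde y,\eta,\widetilde\eta)\in\mathfrak B$, setting $\zeta=\beta(y,\widetilde y,\eta,\widetilde\eta)$, $\widetilde\zeta=\widetilde\beta(y,\widetilde y,\eta,\widetilde\eta)$ and $q=\frac{\widetilde x-\widetilde y}{y-x+\widetilde x-\widetilde y}$: $\zeta$ has mean $y$, $\widetilde\zeta$ has mean $\widetilde y$, $\eta\le_{st}\zeta$, $\widetilde\zeta\le_{st}\widetilde\eta$ and $q\zeta+(1-q)\widetilde\zeta=q\eta+(1-q)\widetilde\eta$. **Construction of $(m_u)$.** For $\pi$ as in the claim, let $G(u)=\int_{\mathbb R}y\,\pi_{F_\mu^{-1}(u)}(dy)$, $\Delta_+(u)=\int_0^u(F_\mu^{-1}-G)^+(v)\,dv$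 and $\Delta_-(u)=\int_0^u(F_\mu^{-1}-G)^-(v)\,dv$ for $u\in[0,1]$ (positive and negative parts); one has $\Delta_+(1)=\Delta_-(1)$. Let $\Delta_\pm^{-1}$ be the left-continuous generalised inverses, $\Delta_\pm^{-1}(w)=\inf\{r\in[0,1]:\Delta_\pm(r)\ge w\}$. Let $\mathcal U^+=\{u\in(0,1): F_\mu^{-1}(u)>G(u)\}$, $\mathcal U^-=\{u\in(0,1): F_\mu^{-1}(u)<G(u)\}$, $\mathcal U^0=\{u\in(0,1): F_\mu^{-1}(u)=G(u)\}$, and $$\phi(u)=\Delta_-^{-1}(\Delta_+(u))\text{ if }u\in\mathcal U^+,\quad\phi(u)=\Delta_+^{-1}(\Delta_-(u))\text{ if }u\in\mathcal U^-,\quad\phi(u)=u\text{ if }u\in\mathcal U^0.$$ For $du$-almost all $u\in\mathcal U^+$ (resp. $\mathcal U^-$) one has $\phi(u)\in\mathcal U^-$ (resp. $\mathcal U^+$), and for such $u$ set $p(u)=\frac{G(\phi(u))-F_\mu^{-1}(\phi(u))}{F_\mu^{-1}(u)-G(u)+G(\phi(u))-F_\mu^{-1}(\phi(u))}$. Let $$A^+=\{u\in\mathcal U^+:\ F_\mu^{-1}(\phi(u))<G(\phi(u)),\ \phi(\phi(u))=u,\ p(\phi(u))=1-p(u)\},$$ $$A^-=\{u\in\mathcal U^-:\ F_\mu^{-1}(\phi(u))>G(\phi(u)),\ \phi(\phi(u))=u,\ p(\phi(u))=1-p(u)\}.$$ Then $\phi(A^+)=A^-$, $\phi(A^-)=A^+$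 and $G(u)<F_\mu^{-1}(u)\le F_\mu^{-1}(\phi(u))<G(\phi(u))$ for $u\in A^+$. Define - for $u\in A^+$: $m_u=\beta\big(F_\mu^{-1}(u),F_\mu^{-1}(\phi(u)),\pi_{F_\mu^{-1}(u)},\pi_{F_\mu^{-1}(\phi(u))}\big)$; - for $u\in A^-$: $m_u=\widetilde\beta\big(F_\mu^{-1}(\phi(u)),F_\mu^{-1}(u),\pi_{F_\mu^{-1}(\phi(u))},\pi_{F_\mu^{-1}(u)}\big)$; - for all other $u\in(0,1)$: $m_u=\pi_{F_\mu^{-1}(u)}$. *)

theory Defs
  imports "HOL-Probability.Probability"
begin

section \<open>Probability measures on the line\<close>

definition finite_moment :: "real \<Rightarrow> real measure set" where
  "finite_moment \<rho> = {\<eta>. real_distribution \<eta> \<and> integrable \<eta> (\<lambda>x. \<bar>x\<bar> powr \<rho>)}"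

definition mean :: "real measure \<Rightarrow> real" where
  "mean \<eta> = (\<integral>y. y \<partial>\<eta>)"

definition quantile :: "real measure \<Rightarrow> real \<Rightarrow> real" where
  "quantile \<eta> u = Inf {x. u \<le> cdf \<eta> x}"

definition st_le :: "real measure \<Rightarrow> real measure \<Rightarrow> bool" where
  "st_le \<eta> \<eta>' \<longleftrightarrow> (\<forall>u\<in>{0<..<1}. quantile \<eta> u \<le> quantile \<eta>' u)"

text \<open>For measures with finite first moment a convex function has an integral in
  \<open>(-\<infinity>, \<infinity>]\<close>. The inequality is void if the right-hand side is infinite, and otherwise
  says that both integrals are finite and ordered.\<close>

definition convex_order :: "real measure \<Rightarrow> real measure \<Rightarrow> bool" where
  "convex_order \<mu> \<nu> \<longleftrightarrow> (\<forall>f. convex_on UNIV f \<and> integrable \<nu> f \<longrightarrow>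
     integrable \<mu> f \<and> (\<integral>x. f x \<partial>\<mu>) \<le> (\<integral>x. f x \<partial>\<nu>))"

section \<open>Couplings and disintegrations\<close>

definition couplings :: "real measure \<Rightarrow> real measure \<Rightarrow> (real \<times> real) measure set" where
  "couplings \<mu> \<nu> = {\<pi>. prob_space \<pi> \<and> sets \<pi> = sets (borel \<Otimes>\<^sub>M borel) \<and>
     distr \<pi> borel fst = \<mu> \<and> distr \<pi> borel snd = \<nu>}"

text \<open>\<open>\<pi>(dx,dy) = \<mu>(dx) \<kappa>\<^sub>x(dy)\<close>, where \<open>\<mu>\<close> is the first marginal of \<open>\<pi>\<close>
  and \<open>return borel x\<close> is the Dirac mass at \<open>x\<close>; only versions with
  all \<open>\<kappa>\<^sub>x\<close> of finite first moment are admitted.\<close>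

definition disintegration ::
    "(real \<times> real) measure \<Rightarrow> (real \<Rightarrow> real measure) \<Rightarrow> bool" where
  "disintegration \<pi> \<kappa> \<longleftrightarrow>
     \<kappa> \<in> borel \<rightarrow>\<^sub>M prob_algebra borel \<and> (\<forall>x. \<kappa> x \<in> finite_moment 1) \<and>
     \<pi> = bind (distr \<pi> borel fst) (\<lambda>x. return borel x \<Otimes>\<^sub>M \<kappa> x)"

definition martingale_couplings ::
    "real measure \<Rightarrow> real measure \<Rightarrow> (real \<times> real) measure set" where
  "martingale_couplings \<mu> \<nu> = {M \<in> couplings \<mu> \<nu>.
     \<exists>\<kappa>. disintegration M \<kappa> \<and> (AE x in \<mu>. mean (\<kappa> x) = x)}"

section \<open>Wasserstein and adapted Wasserstein distances\<close>

definition epowr :: "ennreal \<Rightarrow> real \<Rightarrow> ennreal" where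
  "epowr a p = (if a = \<infinity> then \<infinity> else ennreal (enn2real a powr p))"

definition wasserstein :: "real \<Rightarrow> real measure \<Rightarrow> real measure \<Rightarrow> ennreal" where
  "wasserstein \<rho> \<mu> \<nu> =
     epowr (INF \<pi>\<in>couplings \<mu> \<nu>. \<integral>\<^sup>+ (x, y). ennreal (\<bar>x - y\<bar> powr \<rho>) \<partial>\<pi>) (1 / \<rho>)"

text \<open>A chosen version of the kernel; two versions agree almost everywhere with respect to
  the first marginal, so the distance below does not depend on the choice.\<close>

definition kernel_of :: "(real \<times> real) measure \<Rightarrow> real \<Rightarrow> real measure" where
  "kernel_of \<pi> = (SOME \<kappa>. disintegration \<pi> \<kappa>)"

definition adapted_wasserstein ::
    "real \<Rightarrow> (real \<times> real) measure \<Rightarrow> (real \<times> real) measure \<Rightarrow> ennreal" where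
  "adapted_wasserstein \<rho> \<pi> \<pi>' =
     epowr (INF \<theta>\<in>couplings (distr \<pi> borel fst) (distr \<pi>' borel fst).
        \<integral>\<^sup>+ (x, x'). ennreal (\<bar>x - x'\<bar> powr \<rho>)
           + epowr (wasserstein \<rho> (kernel_of \<pi> x) (kernel_of \<pi>' x')) \<rho> \<partial>\<theta>) (1 / \<rho>)"

definition martingale_rearrangement ::
    "real measure \<Rightarrow> real measure \<Rightarrow> (real \<times> real) measure \<Rightarrow> (real \<times> real) measure \<Rightarrow> bool"
  where
  "martingale_rearrangement \<mu> \<nu> \<pi> M \<longleftrightarrow> M \<in> martingale_couplings \<mu> \<nu> \<and>
     adapted_wasserstein 1 \<pi> M = (INF M'\<in>martingale_couplings \<mu> \<nu>. adapted_wasserstein 1 \<pi> M')"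

definition barycentre_dispersion :: "real measure \<Rightarrow> (real \<Rightarrow> real measure) \<Rightarrow> bool" where
  "barycentre_dispersion \<mu> \<kappa> \<longleftrightarrow>
     (\<forall>a. (\<integral>x. indicator {a..} x * (x - mean (\<kappa> x)) \<partial>\<mu>) \<le> 0)"

section \<open>The selection maps\<close>

text \<open>The \<open>\<sigma>\<close>-algebra that \<open>prob_algebra borel\<close> carries (generated by the evaluations
  \<open>\<eta> \<mapsto> \<eta> A\<close>) is the Borel \<open>\<sigma>\<close>-algebra of weak convergence, the line being Polish.\<close>

definition finite_moment_algebra :: "real measure measure" where
  "finite_moment_algebra = restrict_space (prob_algebra borel) (finite_moment 1)"

definition beta_domain :: "(real \<times> real \<times> real measure \<times> real measure) set" where
  "beta_domain = {(y, y', \<eta>, \<eta>'). \<eta> \<in> finite_moment 1 \<and> \<eta>' \<in> finite_moment 1 \<and>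
     mean \<eta> < y \<and> y \<le> y' \<and> y' < mean \<eta>'}"

definition beta_algebra :: "(real \<times> real \<times> real measure \<times> real measure) measure" where
  "beta_algebra = restrict_space
     (borel \<Otimes>\<^sub>M borel \<Otimes>\<^sub>M finite_moment_algebra \<Otimes>\<^sub>M finite_moment_algebra) beta_domain"

definition beta_maps ::
    "(real \<times> real \<times> real measure \<times> real measure \<Rightarrow> real measure) \<Rightarrow>
     (real \<times> real \<times> real measure \<times> real measure \<Rightarrow> real measure) \<Rightarrow> bool" where
  "beta_maps \<beta> \<beta>' \<longleftrightarrow>
     \<beta> \<in> beta_algebra \<rightarrow>\<^sub>M finite_moment_algebra \<and>
     \<beta>' \<in> beta_algebra \<rightarrow>\<^sub>M finite_moment_algebra \<and>
     (\<forall>(y, y', \<eta>, \<eta>')\<in>beta_domain.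
        let \<zeta> = \<beta> (y, y', \<eta>, \<eta>');
            \<zeta>' = \<beta>' (y, y', \<eta>, \<eta>');
            q = (mean \<eta>' - y') / (y - mean \<eta> + mean \<eta>' - y')
        in mean \<zeta> = y \<and> mean \<zeta>' = y' \<and> st_le \<eta> \<zeta> \<and> st_le \<zeta>' \<eta>' \<and>
           (\<forall>A\<in>sets borel. q * measure \<zeta> A + (1 - q) * measure \<zeta>' A
                           = q * measure \<eta> A + (1 - q) * measure \<eta>' A))"

section \<open>The lifted kernel\<close>

text \<open>In this section \<open>\<kappa>\<close> is a disintegration of a coupling with first marginal \<open>\<mu>\<close>.\<close>

definition bary :: "real measure \<Rightarrow> (real \<Rightarrow> real measure) \<Rightarrow> real \<Rightarrow> real" where
  "bary \<mu> \<kappa> u = mean (\<kappa> (quantile \<mu> u))"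

definition Delta_plus :: "real measure \<Rightarrow> (real \<Rightarrow> real measure) \<Rightarrow> real \<Rightarrow> real" where
  "Delta_plus \<mu> \<kappa> u = (LINT v:{0<..<u}|lborel. max 0 (quantile \<mu> v - bary \<mu> \<kappa> v))"

definition Delta_minus :: "real measure \<Rightarrow> (real \<Rightarrow> real measure) \<Rightarrow> real \<Rightarrow> real" where
  "Delta_minus \<mu> \<kappa> u = (LINT v:{0<..<u}|lborel. max 0 (- (quantile \<mu> v - bary \<mu> \<kappa> v)))"

definition left_inverse :: "(real \<Rightarrow> real) \<Rightarrow> real \<Rightarrow> real" where
  "left_inverse D w = Inf {r \<in> {0..1}. D r \<ge> w}"

definition U_plus :: "real measure \<Rightarrow> (real \<Rightarrow> real measure) \<Rightarrow> real set" where
  "U_plus \<mu> \<kappa> = {u \<in> {0<..<1}. quantile \<mu> u > bary \<mu> \<kappa> u}"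

definition U_minus :: "real measure \<Rightarrow> (real \<Rightarrow> real measure) \<Rightarrow> real set" where
  "U_minus \<mu> \<kappa> = {u \<in> {0<..<1}. quantile \<mu> u < bary \<mu> \<kappa> u}"

definition phi :: "real measure \<Rightarrow> (real \<Rightarrow> real measure) \<Rightarrow> real \<Rightarrow> real" where
  "phi \<mu> \<kappa> u =
     (if u \<in> U_plus \<mu> \<kappa> then left_inverse (Delta_minus \<mu> \<kappa>) (Delta_plus \<mu> \<kappa> u)
      else if u \<in> U_minus \<mu> \<kappa> then left_inverse (Delta_plus \<mu> \<kappa>) (Delta_minus \<mu> \<kappa> u)
      else u)"

definition p_weight :: "real measure \<Rightarrow> (real \<Rightarrow> real measure) \<Rightarrow> real \<Rightarrow> real" where
  "p_weight \<mu> \<kappa> u = (let w = phi \<mu> \<kappa> u in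
     (bary \<mu> \<kappa> w - quantile \<mu> w)
       / (quantile \<mu> u - bary \<mu> \<kappa> u + bary \<mu> \<kappa> w - quantile \<mu> w))"

text \<open>Membership of \<open>\<phi>(u)\<close> in \<open>U_minus\<close> resp. \<open>U_plus\<close> is the inequality between
  \<open>F\<^sub>\<mu>\<^sup>-\<^sup>1(\<phi>(u))\<close> and \<open>G(\<phi>(u))\<close>
  together with \<open>\<phi>(u) \<in> (0,1)\<close>, without which the quantile is not meaningful.\<close>

definition A_plus :: "real measure \<Rightarrow> (real \<Rightarrow> real measure) \<Rightarrow> real set" where
  "A_plus \<mu> \<kappa> = {u \<in> U_plus \<mu> \<kappa>. phi \<mu> \<kappa> u \<in> U_minus \<mu> \<kappa> \<and> phi \<mu> \<kappa> (phi \<mu> \<kappa> u) = u \<and>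
     p_weight \<mu> \<kappa> (phi \<mu> \<kappa> u) = 1 - p_weight \<mu> \<kappa> u}"

definition A_minus :: "real measure \<Rightarrow> (real \<Rightarrow> real measure) \<Rightarrow> real set" where
  "A_minus \<mu> \<kappa> = {u \<in> U_minus \<mu> \<kappa>. phi \<mu> \<kappa> u \<in> U_plus \<mu> \<kappa> \<and> phi \<mu> \<kappa> (phi \<mu> \<kappa> u) = u \<and>
     p_weight \<mu> \<kappa> (phi \<mu> \<kappa> u) = 1 - p_weight \<mu> \<kappa> u}"

definition lifted_kernel ::
    "(real \<times> real \<times> real measure \<times> real measure \<Rightarrow> real measure) \<Rightarrow>
     (real \<times> real \<times> real measure \<times> real measure \<Rightarrow> real measure) \<Rightarrow>
     real measure \<Rightarrow> (real \<Rightarrow> real measure) \<Rightarrow> real \<Rightarrow> real measure" where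
  "lifted_kernel \<beta> \<beta>' \<mu> \<kappa> u =
     (let x = quantile \<mu> u; z = quantile \<mu> (phi \<mu> \<kappa> u) in
      if u \<in> A_plus \<mu> \<kappa> then \<beta> (x, z, \<kappa> x, \<kappa> z)
      else if u \<in> A_minus \<mu> \<kappa> then \<beta>' (z, x, \<kappa> z, \<kappa> x)
      else \<kappa> x)"

text \<open>\<open>M(dx,dy) = \<integral>\<^sub>0\<^sup>1 \<delta>(dx) m\<^sub>u(dy) du\<close>, the Dirac mass being at the quantile of order \<open>u\<close>.\<close>

definition rearranged :: "real measure \<Rightarrow> (real \<Rightarrow> real measure) \<Rightarrow> (real \<times> real) measure" where
  "rearranged \<mu> m =
     bind (restrict_space lborel {0<..<1}) (\<lambda>u. return borel (quantile \<mu> u) \<Otimes>\<^sub>M m u)"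

end

theory Submission
  imports Defs
begin

text \<open>
  Write \<open>x \<mapsto> mean (\<kappa> x)\<close> for the barycentre map of \<open>\<pi>\<close>. The integral of \<open>\<bar>mean (\<kappa> x) - x\<bar>\<close> is a lower bound
  for the distance of \<open>\<pi>\<close> to any martingale coupling: \<open>W\<^sub>1\<close> dominates the difference of the means, and
  when \<open>x\<close> is coupled with \<open>x'\<close>, whose martingale kernel has mean \<open>x'\<close>, the triangle inequality gives
  \<open>\<bar>x - x'\<bar> + \<bar>mean (\<kappa> x) - x'\<bar> \<ge> \<bar>mean (\<kappa> x) - x\<bar>\<close> (\<open>adapted_wasserstein_martingale_ge\<close>). The
  rearranged coupling attains this bound along the diagonal coupling of \<open>\<mu>\<close> with itself, provided that
  its kernel has mean \<open>x\<close> and lies stochastically above \<open>\<kappa> x\<close> where \<open>mean (\<kappa> x) \<le> x\<close> and below it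
  where \<open>x \<le> mean (\<kappa> x)\<close>: for stochastically ordered laws \<open>W\<^sub>1\<close> is the difference of the means.

  The work lies in showing that the construction gives such a kernel. Equip the quantile levels
  \<open>u \<in> (0,1)\<close> with the measures whose densities are the positive part (\<open>excess\<close>) and the negative part
  (\<open>deficit\<close>) of \<open>F\<^sup>-\<^sup>1 - G\<close>. They have the same mass because \<open>\<mu>\<close> and \<open>\<nu>\<close> have the same mean, and \<open>\<phi>\<close> is
  their monotone rearrangement in either direction (\<open>distr_rearrangement\<close>). Hence \<open>\<phi>\<close> is almost everywhere
  an involution exchanging \<open>U_plus\<close> and \<open>U_minus\<close>, so that almost all levels of these sets belong to
  \<open>A_plus\<close> and \<open>A_minus\<close>. Barycentre dispersion says that \<open>\<Delta>\<^sub>- \<le> \<Delta>\<^sub>+\<close>, which forces \<open>u \<le> \<phi>(u)\<close> on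
  \<open>A_plus\<close> and puts the arguments of \<open>\<beta>\<close> into its domain. The change of variables \<open>v = \<phi>(u)\<close> has the
  Jacobian \<open>excess u / deficit (\<phi> u)\<close>, which is exactly the ratio of the weights of the mixture
  preserved by \<open>\<beta>\<close> and \<open>\<beta>'\<close>; therefore the second marginal remains \<open>\<nu>\<close> (\<open>bind_lifted\<close>).

  The kernel \<open>m\<close> is indexed by levels and not by points. A point \<open>x\<close> is turned into a level by the
  distributional transform, which spreads the mass of an atom uniformly over its interval of levels; the
  conditional law of the rearranged coupling at \<open>x\<close> is the average of \<open>m\<close> over the levels of \<open>x\<close>.
  Comparing integrals over sets of points transfers the means and the stochastic order from \<open>m\<close> to
  every disintegration.
\<close>


section \<open>Quantile functions\<close>

abbreviation uniform01 :: "real measure" where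
  "uniform01 \<equiv> restrict_space lborel {0<..<1}"

lemma prob_space_uniform01: "prob_space uniform01"
  by (auto simp: emeasure_restrict_space space_restrict_space intro!: prob_spaceI)

interpretation uniform01: prob_space uniform01
  by (rule prob_space_uniform01)

lemma space_uniform01 [simp]: "space uniform01 = {0<..<1}"
  by (simp add: space_restrict_space)

lemma emeasure_uniform01_Ioc:
  assumes "0 \<le> a" "a \<le> b" "b \<le> 1"
  shows "emeasure uniform01 ({a<..b} \<inter> {0<..<1}) = ennreal (b - a)"
proof -
  have "emeasure uniform01 ({a<..b} \<inter> {0<..<1}) = emeasure lborel ({a<..b} \<inter> {0<..<1})"
    by (subst emeasure_restrict_space) auto
  also have "\<dots> = emeasure lborel {a<..b}"
    using assms AE_lborel_singleton[of 1]
    by (intro emeasure_eq_AE) (auto elim!: eventually_mono)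
  also have "\<dots> = ennreal (b - a)"
    using assms by simp
  finally show ?thesis .
qed

lemma finite_moment_one_iff:
  "\<eta> \<in> finite_moment 1 \<longleftrightarrow> real_distribution \<eta> \<and> integrable \<eta> (\<lambda>x. x)"
proof -
  have "integrable \<eta> (\<lambda>x. \<bar>x\<bar>) \<longleftrightarrow> integrable \<eta> (\<lambda>x. x)" if "real_distribution \<eta>"
    using that integrable_norm_iff[of "\<lambda>x::real. x" \<eta>]
    by (simp add: real_distribution.measurable_finite_borel)
  then show ?thesis
    by (auto simp: finite_moment_def)
qed

lemma finite_moment_real_distribution: "\<eta> \<in> finite_moment 1 \<Longrightarrow> real_distribution \<eta>"
  and finite_moment_integrable: "\<eta> \<in> finite_moment 1 \<Longrightarrow> integrable \<eta> (\<lambda>x. x)"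
  by (simp_all add: finite_moment_one_iff)

context real_distribution
begin

lemma cdf_distribution_M: "cdf_distribution M"
  by (simp add: cdf_distribution_def real_distribution_axioms)

lemma quantile_le_iff:
  assumes "0 < u" "u < 1"
  shows "quantile M u \<le> x \<longleftrightarrow> u \<le> cdf M x"
proof -
  interpret cdf_distribution M by (rule cdf_distribution_M)
  show ?thesis
    unfolding quantile_def using pseudoinverse[OF assms] by blast
qed

lemma quantile_mono:
  assumes "0 < u" "u \<le> v" "v < 1"
  shows "quantile M u \<le> quantile M v"
proof -
  have "v \<le> cdf M (quantile M v)"
    using assms quantile_le_iff[of v "quantile M v"] by linarith
  with assms show ?thesis
    by (intro iffD2[OF quantile_le_iff]) auto
qed

text \<open>Outside the unit interval \<open>quantile M\<close> takes three constant default values, so it is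
  Borel on the whole line.\<close>

lemma measurable_quantile [measurable]: "quantile M \<in> borel_measurable borel"
proof -
  interpret cdf_distribution M by (rule cdf_distribution_M)
  have Q: "quantile M = I"
    by (auto simp: quantile_def fun_eq_iff)
  define q where "q u = (if u \<in> {0<..<1} then quantile M u else 0)" for u
  have [measurable]: "q \<in> borel_measurable borel"
    using measurable_CI measurable_restrict_space_iff[of "{0<..<1::real}" borel 0 borel "quantile M"]
    unfolding q_def[abs_def] Q by simp
  have "{x. u \<le> cdf M x} = UNIV" if "u \<le> 0" for u
    using that cdf_nonneg order_trans by blast
  moreover have "{x. u \<le> cdf M x} = {}" if "1 < u" for u
    using that cdf_bounded_prob by (auto simp: not_le intro: le_less_trans)
  moreover define c where "c = quantile M 1"
  ultimately have "quantile M = (\<lambda>u. if u \<in> {0<..<1} then q u else if u \<le> 0 then Inf UNIV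
      else if u = 1 then c else Inf {})"
    by (auto simp: q_def quantile_def fun_eq_iff)
  moreover have "\<dots> \<in> borel_measurable borel"
    by measurable
  ultimately show ?thesis
    by simp
qed

lemma measurable_quantile_uniform01 [measurable]: "quantile M \<in> borel_measurable uniform01"
  using measurable_restrict_space1[OF measurable_quantile] by (simp cong: measurable_cong_sets)

lemma distr_quantile: "distr uniform01 borel (quantile M) = M"
proof -
  interpret cdf_distribution M by (rule cdf_distribution_M)
  show ?thesis
    using distr_I_eq_M by (simp add: quantile_def[abs_def])
qed

end

lemma st_le_imp_cdf_le:
  assumes "real_distribution \<eta>" "real_distribution \<zeta>" "st_le \<eta> \<zeta>"
  shows "cdf \<zeta> t \<le> cdf \<eta> t"
proof (rule dense_le)
  fix u assume u: "u < cdf \<zeta> t"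
  interpret \<eta>: real_distribution \<eta> by fact
  interpret \<zeta>: real_distribution \<zeta> by fact
  show "u \<le> cdf \<eta> t"
  proof (cases "0 < u")
    case True
    have u1: "u < 1"
      using u \<zeta>.cdf_bounded_prob[of t] by simp
    have "quantile \<eta> u \<le> quantile \<zeta> u"
      using assms(3) True u1 by (simp add: st_le_def)
    also have "\<dots> \<le> t"
      using u u1 True by (simp add: \<zeta>.quantile_le_iff)
    finally show ?thesis
      using u1 True by (simp add: \<eta>.quantile_le_iff)
  qed (use \<eta>.cdf_nonneg[of t] in simp)
qed

lemma cdf_le_imp_quantile_le:
  assumes "real_distribution \<eta>" "real_distribution \<zeta>" "\<And>t. cdf \<zeta> t \<le> cdf \<eta> t" "0 < u" "u < 1"
  shows "quantile \<eta> u \<le> quantile \<zeta> u"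
proof -
  have "u \<le> cdf \<zeta> (quantile \<zeta> u)"
    using real_distribution.quantile_le_iff[OF assms(2,4,5)] by auto
  also have "\<dots> \<le> cdf \<eta> (quantile \<zeta> u)"
    by (rule assms(3))
  finally show ?thesis
    using real_distribution.quantile_le_iff[OF assms(1,4,5)] by auto
qed

section \<open>The Wasserstein distance of order one\<close>

lemma epowr_one [simp]: "epowr a 1 = a"
  by (cases a) (auto simp: epowr_def)

lemma wasserstein_one:
  "wasserstein 1 \<eta> \<zeta> = (INF \<pi>\<in>couplings \<eta> \<zeta>. \<integral>\<^sup>+ (x, y). ennreal \<bar>x - y\<bar> \<partial>\<pi>)"
  by (simp add: wasserstein_def)

lemma adapted_wasserstein_one:
  "adapted_wasserstein 1 \<pi> \<pi>' =
     (INF \<theta>\<in>couplings (distr \<pi> borel fst) (distr \<pi>' borel fst).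
        \<integral>\<^sup>+ (x, x'). ennreal \<bar>x - x'\<bar> + wasserstein 1 (kernel_of \<pi> x) (kernel_of \<pi>' x') \<partial>\<theta>)"
  by (simp add: adapted_wasserstein_def)

text \<open>The identity is a test function of Lipschitz constant one.\<close>

lemma wasserstein_ge_mean_diff:
  assumes "\<eta> \<in> finite_moment 1" "\<zeta> \<in> finite_moment 1"
  shows "ennreal \<bar>mean \<eta> - mean \<zeta>\<bar> \<le> wasserstein 1 \<eta> \<zeta>"
  unfolding wasserstein_one
proof (rule INF_greatest)
  fix \<pi> assume "\<pi> \<in> couplings \<eta> \<zeta>"
  then have [measurable_cong]: "sets \<pi> = sets (borel \<Otimes>\<^sub>M borel)"
    and \<eta>: "distr \<pi> borel fst = \<eta>" and \<zeta>: "distr \<pi> borel snd = \<zeta>"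
    by (auto simp: couplings_def)
  have m: "fst \<in> borel_measurable \<pi>" "snd \<in> borel_measurable \<pi>"
    by measurable
  have int: "integrable \<pi> fst" "integrable \<pi> snd"
    using assms[THEN finite_moment_integrable] integrable_distr[OF m(1), of "\<lambda>x. x"]
      integrable_distr[OF m(2), of "\<lambda>x. x"]
    unfolding \<eta> \<zeta> by simp_all
  have "mean \<eta> = (\<integral>p. fst p \<partial>\<pi>)" "mean \<zeta> = (\<integral>p. snd p \<partial>\<pi>)"
    using integral_distr[OF m(1), of "\<lambda>x. x"] integral_distr[OF m(2), of "\<lambda>x. x"]
    unfolding \<eta> \<zeta> mean_def by simp_all
  then have "mean \<eta> - mean \<zeta> = (\<integral>p. fst p - snd p \<partial>\<pi>)"
    using int by simp
  then have "ennreal \<bar>mean \<eta> - mean \<zeta>\<bar> \<le> (\<integral>\<^sup>+p. ennreal (norm (fst p - snd p)) \<partial>\<pi>)"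
    using int integral_norm_bound_ennreal[of \<pi> "\<lambda>p. fst p - snd p"] by simp
  also have "\<dots> = (\<integral>\<^sup>+ (x, y). ennreal \<bar>x - y\<bar> \<partial>\<pi>)"
    by (intro nn_integral_cong) auto
  finally show "ennreal \<bar>mean \<eta> - mean \<zeta>\<bar> \<le> (\<integral>\<^sup>+ (x, y). ennreal \<bar>x - y\<bar> \<partial>\<pi>)" .
qed

text \<open>The comonotone coupling moves mass in one direction only when the two laws are
  stochastically ordered, so that its cost is the difference of the means.\<close>

lemma wasserstein_le_mean_diff:
  assumes fm: "\<eta> \<in> finite_moment 1" "\<zeta> \<in> finite_moment 1" and cdf: "\<And>t. cdf \<zeta> t \<le> cdf \<eta> t"
  shows "wasserstein 1 \<eta> \<zeta> \<le> ennreal (mean \<zeta> - mean \<eta>)"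
    and "wasserstein 1 \<zeta> \<eta> \<le> ennreal (mean \<zeta> - mean \<eta>)"
proof -
  interpret \<eta>: real_distribution \<eta> by (rule finite_moment_real_distribution) fact
  interpret \<zeta>: real_distribution \<zeta> by (rule finite_moment_real_distribution) fact
  have int: "integrable uniform01 (quantile \<eta>)" "integrable uniform01 (quantile \<zeta>)"
    using fm[THEN finite_moment_integrable]
      integrable_distr[OF \<eta>.measurable_quantile_uniform01, of "\<lambda>x. x"]
      integrable_distr[OF \<zeta>.measurable_quantile_uniform01, of "\<lambda>x. x"]
    unfolding \<eta>.distr_quantile \<zeta>.distr_quantile by simp_all
  have mean: "mean \<eta> = (\<integral>u. quantile \<eta> u \<partial>uniform01)" "mean \<zeta> = (\<integral>u. quantile \<zeta> u \<partial>uniform01)"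
    using integral_distr[OF \<eta>.measurable_quantile_uniform01, of "\<lambda>x. x"]
      integral_distr[OF \<zeta>.measurable_quantile_uniform01, of "\<lambda>x. x"]
    unfolding \<eta>.distr_quantile \<zeta>.distr_quantile mean_def by simp_all
  have le: "quantile \<eta> u \<le> quantile \<zeta> u" if "u \<in> {0<..<1}" for u
    using that cdf
    by (intro cdf_le_imp_quantile_le \<eta>.real_distribution_axioms \<zeta>.real_distribution_axioms) auto
  have cost: "(\<integral>\<^sup>+u. ennreal \<bar>quantile \<eta> u - quantile \<zeta> u\<bar> \<partial>uniform01) = ennreal (mean \<zeta> - mean \<eta>)"
  proof -
    have "(\<integral>\<^sup>+u. ennreal \<bar>quantile \<eta> u - quantile \<zeta> u\<bar> \<partial>uniform01)
        = (\<integral>\<^sup>+u. ennreal (quantile \<zeta> u - quantile \<eta> u) \<partial>uniform01)"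
      using le by (intro nn_integral_cong) auto
    also have "\<dots> = ennreal (\<integral>u. quantile \<zeta> u - quantile \<eta> u \<partial>uniform01)"
      using int le by (intro nn_integral_eq_integral) (auto intro!: AE_I2)
    finally show ?thesis
      using int by (simp add: mean)
  qed
  let ?\<pi> = "distr uniform01 (borel \<Otimes>\<^sub>M borel) (\<lambda>u. (quantile \<eta> u, quantile \<zeta> u))"
  let ?\<pi>' = "distr uniform01 (borel \<Otimes>\<^sub>M borel) (\<lambda>u. (quantile \<zeta> u, quantile \<eta> u))"
  have "?\<pi> \<in> couplings \<eta> \<zeta>" "?\<pi>' \<in> couplings \<zeta> \<eta>"
    by (auto simp: couplings_def distr_distr comp_def \<eta>.distr_quantile \<zeta>.distr_quantile
        intro!: uniform01.prob_space_distr)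
  moreover have "(\<integral>\<^sup>+ (x, y). ennreal \<bar>x - y\<bar> \<partial>?\<pi>) = ennreal (mean \<zeta> - mean \<eta>)"
      "(\<integral>\<^sup>+ (x, y). ennreal \<bar>x - y\<bar> \<partial>?\<pi>') = ennreal (mean \<zeta> - mean \<eta>)"
    using cost by (simp_all add: nn_integral_distr split_beta' abs_minus_commute)
  ultimately show "wasserstein 1 \<eta> \<zeta> \<le> ennreal (mean \<zeta> - mean \<eta>)"
      "wasserstein 1 \<zeta> \<eta> \<le> ennreal (mean \<zeta> - mean \<eta>)"
    unfolding wasserstein_one by (auto intro!: INF_lower2)
qed


section \<open>Kernels and disintegrations\<close>

text \<open>A base point \<open>u\<close> is drawn from \<open>N\<close>, displayed as \<open>f u\<close>, and the second coordinate is drawn from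
  \<open>k u\<close>. With \<open>f\<close> the identity this is a disintegration, with \<open>f\<close> a quantile function it is the form
  of the rearranged coupling.\<close>

definition semidirect ::
    "'a measure \<Rightarrow> ('a \<Rightarrow> real) \<Rightarrow> ('a \<Rightarrow> real measure) \<Rightarrow> (real \<times> real) measure" where
  "semidirect N f k = bind N (\<lambda>u. return borel (f u) \<Otimes>\<^sub>M k u)"

lemma kernel_real_distribution:
  assumes "k \<in> N \<rightarrow>\<^sub>M prob_algebra borel" "u \<in> space N"
  shows "real_distribution (k u)"
  using measurable_space[OF assms]
  by (simp add: space_prob_algebra real_distribution_def real_distribution_axioms_def)

locale real_kernel = prob_space N for N :: "'a measure" +
  fixes f :: "'a \<Rightarrow> real" and k :: "'a \<Rightarrow> real measure"
  assumes f_measurable: "f \<in> borel_measurable N"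
    and k_measurable [measurable]: "k \<in> N \<rightarrow>\<^sub>M prob_algebra borel"
begin

lemma N_in_prob_algebra: "N \<in> space (prob_algebra N)"
  by (simp add: space_prob_algebra prob_space_axioms)

lemma graph_measurable [measurable]:
  "(\<lambda>u. return borel (f u) \<Otimes>\<^sub>M k u) \<in> N \<rightarrow>\<^sub>M prob_algebra (borel \<Otimes>\<^sub>M borel)"
  using f_measurable by measurable

lemma sets_semidirect [measurable_cong]: "sets (semidirect N f k) = sets (borel \<Otimes>\<^sub>M borel)"
  unfolding semidirect_def by (rule sets_bind'[OF N_in_prob_algebra graph_measurable])

lemma prob_space_semidirect: "prob_space (semidirect N f k)"
  unfolding semidirect_def by (rule prob_space_bind'[OF N_in_prob_algebra graph_measurable])

lemma real_distribution_kernel: "u \<in> space N \<Longrightarrow> real_distribution (k u)"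
  by (rule kernel_real_distribution[OF k_measurable])

lemma integrable_indicator_kernel:
  assumes [measurable]: "A \<in> sets borel" "B \<in> sets borel"
  shows "integrable N (\<lambda>u. indicator A (f u) * measure (k u) B)"
proof (rule integrable_const_bound[where B=1])
  note [measurable] = f_measurable
  show "AE u in N. norm (indicator A (f u) * measure (k u) B) \<le> 1"
    using real_distribution_kernel
    by (intro AE_I2) (auto simp: indicator_def real_distribution_def intro: prob_space.prob_le_1)
  show "(\<lambda>u. indicator A (f u) * measure (k u) B) \<in> borel_measurable N"
    by (intro borel_measurable_times measure_measurable_prob_algebra2[OF _ k_measurable]) auto
qed

lemma measure_semidirect_Times:
  assumes [measurable]: "A \<in> sets borel" "B \<in> sets borel"
  shows "measure (semidirect N f k) (A \<times> B) = (\<integral>u. indicator A (f u) * measure (k u) B \<partial>N)"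
proof -
  have eq: "emeasure (return borel (f u) \<Otimes>\<^sub>M k u) (A \<times> B)
      = ennreal (indicator A (f u) * measure (k u) B)" if "u \<in> space N" for u
  proof -
    interpret k: real_distribution "k u"
      by (rule real_distribution_kernel) fact
    show ?thesis
      by (subst k.emeasure_pair_measure_Times)
         (auto simp: indicator_def k.emeasure_eq_measure)
  qed
  have "emeasure (semidirect N f k) (A \<times> B)
      = (\<integral>\<^sup>+u. emeasure (return borel (f u) \<Otimes>\<^sub>M k u) (A \<times> B) \<partial>N)"
    unfolding semidirect_def
    by (rule emeasure_bind_prob_algebra[OF N_in_prob_algebra graph_measurable]) simp
  also have "\<dots> = (\<integral>\<^sup>+u. ennreal (indicator A (f u) * measure (k u) B) \<partial>N)"
    by (intro nn_integral_cong eq)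
  also have "\<dots> = ennreal (\<integral>u. indicator A (f u) * measure (k u) B \<partial>N)"
    by (intro nn_integral_eq_integral integrable_indicator_kernel assms) (auto simp: indicator_def)
  finally show ?thesis
    by (auto simp: measure_def indicator_def intro!: integral_nonneg_AE)
qed

lemma distr_fst_semidirect: "distr (semidirect N f k) borel fst = distr N borel f"
proof (rule measure_eqI)
  note [measurable] = f_measurable
  fix A assume "A \<in> sets (distr (semidirect N f k) borel fst)"
  then have A [measurable]: "A \<in> sets borel"
    by simp
  interpret s: prob_space "semidirect N f k"
    by (rule prob_space_semidirect)
  have space: "space (semidirect N f k) = UNIV"
    using sets_eq_imp_space_eq[OF sets_semidirect] by (simp add: space_pair_measure)
  have "emeasure (distr (semidirect N f k) borel fst) A = emeasure (semidirect N f k) (A \<times> UNIV)"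
    by (subst emeasure_distr) (auto simp: space intro!: arg_cong2[where f=emeasure])
  also have "\<dots> = ennreal (\<integral>u. indicator A (f u) * measure (k u) UNIV \<partial>N)"
    by (simp add: s.emeasure_eq_measure measure_semidirect_Times)
  also have "(\<integral>u. indicator A (f u) * measure (k u) UNIV \<partial>N) = (\<integral>u. indicator (f -` A \<inter> space N) u \<partial>N)"
  proof (rule Bochner_Integration.integral_cong[OF refl])
    fix u assume u: "u \<in> space N"
    interpret k: real_distribution "k u"
      by (rule real_distribution_kernel) fact
    show "indicator A (f u) * measure (k u) UNIV = indicator (f -` A \<inter> space N) u"
      using u k.prob_space by (auto simp: indicator_def)
  qed
  also have "ennreal \<dots> = emeasure (distr N borel f) A"
    by (simp add: emeasure_distr emeasure_eq_measure)
  finally show "emeasure (distr (semidirect N f k) borel fst) A = emeasure (distr N borel f) A" .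
qed simp

lemma distr_snd_semidirect: "distr (semidirect N f k) borel snd = bind N k"
proof (rule measure_eqI)
  fix B assume "B \<in> sets (distr (semidirect N f k) borel snd)"
  then have B [measurable]: "B \<in> sets borel"
    by simp
  interpret s: prob_space "semidirect N f k"
    by (rule prob_space_semidirect)
  have space: "space (semidirect N f k) = UNIV"
    using sets_eq_imp_space_eq[OF sets_semidirect] by (simp add: space_pair_measure)
  have "emeasure (distr (semidirect N f k) borel snd) B = emeasure (semidirect N f k) (UNIV \<times> B)"
    by (subst emeasure_distr) (auto simp: space intro!: arg_cong2[where f=emeasure])
  also have "\<dots> = ennreal (\<integral>u. measure (k u) B \<partial>N)"
    by (simp add: s.emeasure_eq_measure measure_semidirect_Times)
  also have "\<dots> = ennreal (measure (bind N k) B)"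
    by (subst measure_bind[OF measurable_prob_algebraD[OF k_measurable] B]) simp
  also have "\<dots> = emeasure (bind N k) B"
  proof -
    interpret b: prob_space "bind N k"
      by (rule prob_space_bind'[OF N_in_prob_algebra k_measurable])
    show ?thesis by (simp add: b.emeasure_eq_measure)
  qed
  finally show "emeasure (distr (semidirect N f k) borel snd) B = emeasure (bind N k) B" .
qed (simp add: sets_bind'[OF N_in_prob_algebra k_measurable])

end

lemma prob_measure_eqI_Times:
  fixes \<pi> \<pi>' :: "(real \<times> real) measure"
  assumes "prob_space \<pi>" "prob_space \<pi>'"
    and sets: "sets \<pi> = sets (borel \<Otimes>\<^sub>M borel)" "sets \<pi>' = sets (borel \<Otimes>\<^sub>M borel)"
    and eq: "\<And>A B. A \<in> sets borel \<Longrightarrow> B \<in> sets borel \<Longrightarrow> measure \<pi> (A \<times> B) = measure \<pi>' (A \<times> B)"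
  shows "\<pi> = \<pi>'"
proof -
  interpret \<pi>: prob_space \<pi> by fact
  interpret \<pi>': prob_space \<pi>' by fact
  let ?E = "{a \<times> b | a b. a \<in> sets (borel::real measure) \<and> b \<in> sets (borel::real measure)}"
  show ?thesis
  proof (rule measure_eqI_generator_eq[where E="?E" and \<Omega>=UNIV and A="\<lambda>_. UNIV"])
    show "Int_stable ?E"
      by (rule Int_stable_pair_measure_generator)
    show "sets \<pi> = sigma_sets UNIV ?E" "sets \<pi>' = sigma_sets UNIV ?E"
      unfolding sets by (simp_all add: sets_pair_measure)
    show "emeasure \<pi> X = emeasure \<pi>' X" if "X \<in> ?E" for X
      using that by (auto simp: \<pi>.emeasure_eq_measure \<pi>'.emeasure_eq_measure eq)
    show "range (\<lambda>_. UNIV) \<subseteq> ?E"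
      by (auto intro!: exI[of _ UNIV])
  qed auto
qed

text \<open>A law without first moment has the default integral \<open>0\<close>, and the laws with first moment form
  a measurable set.\<close>

lemma measurable_mean [measurable]: "mean \<in> borel_measurable (prob_algebra borel)"
proof -
  have "mean = (\<lambda>\<eta>. if integrable \<eta> (\<lambda>y. y) then
      enn2real (\<integral>\<^sup>+y. ennreal y \<partial>\<eta>) - enn2real (\<integral>\<^sup>+y. ennreal (- y) \<partial>\<eta>) else 0)"
    by (auto simp: mean_def fun_eq_iff real_lebesgue_integral_def not_integrable_integral_eq)
  moreover have "\<dots> \<in> borel_measurable (subprob_algebra borel)"
    by measurable
  ultimately show ?thesis
    unfolding prob_algebra_def by (simp add: measurable_restrict_space1)
qed

lemma measurable_mean_kernel:
  assumes "k \<in> N \<rightarrow>\<^sub>M prob_algebra borel"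
  shows "(\<lambda>u. mean (k u)) \<in> borel_measurable N"
  using measurable_compose[OF assms measurable_mean] .

text \<open>The law of total expectation. The integrals of the positive and the negative part are treated as
  extended reals, where integrals against a mixture are iterated integrals; the moment of the mixture
  makes them finite almost everywhere.\<close>

lemma mean_bind:
  assumes "prob_space N" and k: "k \<in> N \<rightarrow>\<^sub>M prob_algebra borel"
    and fm: "bind N k \<in> finite_moment 1"
  shows "AE u in N. integrable (k u) (\<lambda>y. y)"
    and "integrable N (\<lambda>u. mean (k u))"
    and "mean (bind N k) = (\<integral>u. mean (k u) \<partial>N)"
proof -
  interpret prob_space N by fact
  note k' = measurable_prob_algebraD[OF k]
  have meas: "g \<in> borel_measurable (bind N k)" "g \<in> borel_measurable (k u)"
    if "g \<in> borel_measurable borel" "u \<in> space N" for g :: "real \<Rightarrow> real" and u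
    using that kernel_real_distribution[OF k] finite_moment_real_distribution[OF fm]
    by (auto intro: real_distribution.measurable_finite_borel)
  have part: "integrable N (\<lambda>u. enn2real (\<integral>\<^sup>+y. ennreal (g y) \<partial>k u))
      \<and> (\<integral>u. enn2real (\<integral>\<^sup>+y. ennreal (g y) \<partial>k u) \<partial>N) = enn2real (\<integral>\<^sup>+y. ennreal (g y) \<partial>bind N k)
      \<and> (AE u in N. (\<integral>\<^sup>+y. ennreal (g y) \<partial>k u) < \<infinity>)"
    if g [measurable]: "g \<in> borel_measurable borel" and le: "\<And>y. g y \<le> \<bar>y\<bar>" for g :: "real \<Rightarrow> real"
  proof -
    let ?h = "\<lambda>u. \<integral>\<^sup>+y. ennreal (g y) \<partial>k u"
    have m [measurable]: "?h \<in> borel_measurable N"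
      using k' by measurable
    have eq: "(\<integral>\<^sup>+u. ?h u \<partial>N) = (\<integral>\<^sup>+y. ennreal (g y) \<partial>bind N k)"
      by (rule nn_integral_bind[OF _ k', symmetric]) measurable
    also have "\<dots> \<le> (\<integral>\<^sup>+y. ennreal (norm y) \<partial>bind N k)"
      using le by (intro nn_integral_mono ennreal_leI) auto
    also have "\<dots> < \<infinity>"
      using finite_moment_integrable[OF fm] by (simp add: integrable_iff_bounded)
    finally have fin: "(\<integral>\<^sup>+u. ?h u \<partial>N) < \<infinity>" .
    then have ae: "AE u in N. ?h u < \<infinity>"
      using nn_integral_noteq_infinite[OF m] by (auto simp: top.not_eq_extremum)
    then have "(\<integral>\<^sup>+u. ennreal (enn2real (?h u)) \<partial>N) = (\<integral>\<^sup>+u. ?h u \<partial>N)"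
      by (intro nn_integral_cong_AE) (auto elim!: eventually_mono)
    then show ?thesis
      using fin ae eq m
      by (auto simp: integrable_iff_bounded integral_eq_nn_integral)
  qed
  note pos = part[of "\<lambda>y. y"] and neg = part[of "\<lambda>y. - y"]
  have "AE u in N. (\<integral>\<^sup>+y. ennreal y \<partial>k u) < \<infinity>" "AE u in N. (\<integral>\<^sup>+y. ennreal (- y) \<partial>k u) < \<infinity>"
    using pos neg by auto
  then show ae: "AE u in N. integrable (k u) (\<lambda>y. y)"
    using AE_space by eventually_elim (auto simp: real_integrable_def meas)
  have ae_mean: "AE u in N. mean (k u)
      = enn2real (\<integral>\<^sup>+y. ennreal y \<partial>k u) - enn2real (\<integral>\<^sup>+y. ennreal (- y) \<partial>k u)"
    using ae by eventually_elim (auto simp: mean_def real_lebesgue_integral_def)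
  have int: "integrable N (\<lambda>u. enn2real (\<integral>\<^sup>+y. ennreal y \<partial>k u) - enn2real (\<integral>\<^sup>+y. ennreal (- y) \<partial>k u))"
    using pos neg by auto
  show "integrable N (\<lambda>u. mean (k u))"
    using ae_mean
    by (intro integrable_cong_AE_imp[OF int measurable_mean_kernel[OF k]]) (auto elim!: eventually_mono)
  have "mean (bind N k) = enn2real (\<integral>\<^sup>+y. ennreal y \<partial>bind N k) - enn2real (\<integral>\<^sup>+y. ennreal (- y) \<partial>bind N k)"
    using finite_moment_integrable[OF fm] by (simp add: mean_def real_lebesgue_integral_def)
  also have "\<dots> = (\<integral>u. enn2real (\<integral>\<^sup>+y. ennreal y \<partial>k u) - enn2real (\<integral>\<^sup>+y. ennreal (- y) \<partial>k u) \<partial>N)"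
    using pos neg by simp
  also have "\<dots> = (\<integral>u. mean (k u) \<partial>N)"
    using ae_mean measurable_mean_kernel[OF k] int
    by (intro integral_cong_AE) (auto elim!: eventually_mono)
  finally show "mean (bind N k) = (\<integral>u. mean (k u) \<partial>N)" .
qed

text \<open>A family of inequalities between integrals over sets localises to an inequality at almost
  every point; countably many thresholds suffice as distribution functions are right-continuous.\<close>

lemma kernel_cdf_le_AE:
  fixes \<mu> :: "real measure"
  assumes "real_distribution \<mu>"
    and K [measurable]: "K \<in> borel \<rightarrow>\<^sub>M prob_algebra borel"
    and K' [measurable]: "K' \<in> borel \<rightarrow>\<^sub>M prob_algebra borel"
    and S [measurable]: "S \<in> sets borel"
    and le: "\<And>A t. A \<in> sets borel \<Longrightarrow> A \<subseteq> S \<Longrightarrow>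
      (\<integral>x. indicator A x * measure (K x) {..t} \<partial>\<mu>) \<le> (\<integral>x. indicator A x * measure (K' x) {..t} \<partial>\<mu>)"
  shows "AE x in \<mu>. x \<in> S \<longrightarrow> (\<forall>t. cdf (K x) t \<le> cdf (K' x) t)"
proof -
  interpret \<mu>: real_distribution \<mu> by fact
  interpret K: real_distribution "K x" for x
    by (rule kernel_real_distribution[OF K]) simp
  interpret K': real_distribution "K' x" for x
    by (rule kernel_real_distribution[OF K']) simp
  have m [measurable]: "(\<lambda>x. measure (K x) {..t}) \<in> borel_measurable borel"
      "(\<lambda>x. measure (K' x) {..t}) \<in> borel_measurable borel" for t
    by (auto intro!: measure_measurable_prob_algebra2[OF _ K] measure_measurable_prob_algebra2[OF _ K'])
  have int: "integrable \<mu> (\<lambda>x. indicator A x * measure (K x) {..t})"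
      "integrable \<mu> (\<lambda>x. indicator A x * measure (K' x) {..t})" if [measurable]: "A \<in> sets borel" for A t
    by (auto intro!: \<mu>.integrable_const_bound[where B=1] AE_I2 simp: indicator_def)
  have ae: "AE x in \<mu>. x \<in> S \<longrightarrow> cdf (K x) t \<le> cdf (K' x) t" for t
  proof -
    define A where "A = {x \<in> S. measure (K' x) {..t} < measure (K x) {..t}}"
    have A [measurable]: "A \<in> sets borel"
      unfolding A_def by measurable
    define h where "h x = indicator A x * measure (K x) {..t} - indicator A x * measure (K' x) {..t}" for x
    have h: "integrable \<mu> h" "\<And>x. 0 \<le> h x"
      unfolding h_def using int[OF A] by (auto simp: A_def indicator_def)
    have "(\<integral>x. h x \<partial>\<mu>) \<le> 0"
      unfolding h_def using int[OF A] le[OF A] by (auto simp: A_def)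
    then have "(\<integral>x. h x \<partial>\<mu>) = 0"
      using h(2) by (intro antisym integral_nonneg_AE) auto
    then have "AE x in \<mu>. h x = 0"
      using h integral_nonneg_eq_0_iff_AE[of \<mu> h] by auto
    then show ?thesis
      by eventually_elim (auto simp: h_def A_def cdf_def not_less indicator_def split: if_splits)
  qed
  have "AE x in \<mu>. \<forall>t\<in>\<rat>. x \<in> S \<longrightarrow> cdf (K x) t \<le> cdf (K' x) t"
    using ae by (intro AE_ball_countable[THEN iffD2] countable_rat) auto
  then show ?thesis
  proof eventually_elim
    case (elim x)
    have "cdf (K x) t \<le> cdf (K' x) t" if x: "x \<in> S" for t
    proof (rule dense_ge)
      fix c assume "cdf (K' x) t < c"
      then have "\<forall>\<^sub>F s in at_right t. cdf (K' x) s < c"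
        using K'.cdf_is_right_cont[of t x] by (auto simp: continuous_within intro: order_tendstoD(2))
      then obtain b where b: "t < b" "\<And>s. t < s \<Longrightarrow> s < b \<Longrightarrow> cdf (K' x) s < c"
        by (auto simp: eventually_at_right_field)
      obtain q where q: "q \<in> \<rat>" "t < q" "q < b"
        using Rats_dense_in_real[OF b(1)] by auto
      have "cdf (K x) t \<le> cdf (K x) q"
        using q by (intro K.cdf_nondecreasing) auto
      also have "\<dots> \<le> cdf (K' x) q"
        using elim q x by auto
      also have "\<dots> \<le> c"
        using b q by (intro less_imp_le) auto
      finally show "cdf (K x) t \<le> c" .
    qed
    then show ?case by blast
  qed
qed

lemma couplingsD:
  assumes "\<pi> \<in> couplings \<mu> \<nu>"
  shows "prob_space \<pi>" "sets \<pi> = sets (borel \<Otimes>\<^sub>M borel)"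
    "distr \<pi> borel fst = \<mu>" "distr \<pi> borel snd = \<nu>" "real_distribution \<mu>" "real_distribution \<nu>"
proof -
  show \<pi>: "prob_space \<pi>" and s: "sets \<pi> = sets (borel \<Otimes>\<^sub>M borel)"
    and d: "distr \<pi> borel fst = \<mu>" "distr \<pi> borel snd = \<nu>"
    using assms by (auto simp: couplings_def)
  have m: "fst \<in> borel_measurable \<pi>" "snd \<in> borel_measurable \<pi>"
    by (simp_all cong: measurable_cong_sets add: s)
  show "real_distribution \<mu>" "real_distribution \<nu>"
    using prob_space.real_distribution_distr[OF \<pi> m(1)] prob_space.real_distribution_distr[OF \<pi> m(2)]
    by (simp_all add: d)
qed

locale disintegrated_coupling =
  fixes \<mu> \<nu> \<pi> \<kappa>
  assumes coupling: "\<pi> \<in> couplings \<mu> \<nu>" and disintegration: "disintegration \<pi> \<kappa>"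
begin

lemma kernel_measurable [measurable]: "\<kappa> \<in> borel \<rightarrow>\<^sub>M prob_algebra borel"
  and kernel_moment: "\<kappa> x \<in> finite_moment 1"
  using disintegration by (auto simp: disintegration_def)

sublocale \<mu>: real_distribution \<mu>
  using couplingsD[OF coupling] by simp

sublocale \<nu>: real_distribution \<nu>
  using couplingsD[OF coupling] by simp

sublocale real_kernel \<mu> "\<lambda>x. x" \<kappa>
  using kernel_measurable by unfold_locales (auto cong: measurable_cong_sets)

lemma coupling_eq: "\<pi> = semidirect \<mu> (\<lambda>x. x) \<kappa>"
  using disintegration couplingsD(3)[OF coupling] by (simp add: disintegration_def semidirect_def)

lemma second_marginal_eq: "\<nu> = bind \<mu> \<kappa>"
  using distr_snd_semidirect couplingsD(4)[OF coupling] by (simp flip: coupling_eq)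

lemma measure_Times:
  "A \<in> sets borel \<Longrightarrow> B \<in> sets borel \<Longrightarrow>
    measure \<pi> (A \<times> B) = (\<integral>x. indicator A x * measure (\<kappa> x) B \<partial>\<mu>)"
  using measure_semidirect_Times by (simp flip: coupling_eq)

lemma kernel_unique_AE:
  assumes "disintegration \<pi> K"
  shows "AE x in \<mu>. K x = \<kappa> x"
proof -
  interpret K: disintegrated_coupling \<mu> \<nu> \<pi> K
    using coupling assms by unfold_locales
  have "AE x in \<mu>. x \<in> UNIV \<longrightarrow> (\<forall>t. cdf (K x) t \<le> cdf (\<kappa> x) t)"
    "AE x in \<mu>. x \<in> UNIV \<longrightarrow> (\<forall>t. cdf (\<kappa> x) t \<le> cdf (K x) t)"
    by (intro kernel_cdf_le_AE \<mu>.real_distribution_axioms kernel_measurable K.kernel_measurable;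
        simp add: measure_Times[symmetric] K.measure_Times[symmetric])+
  then show ?thesis
  proof eventually_elim
    case (elim x)
    then have "cdf (K x) = cdf (\<kappa> x)"
      by (intro ext antisym) auto
    then show ?case
      by (intro cdf_unique finite_moment_real_distribution kernel_moment K.kernel_moment)
  qed
qed

lemma disintegration_kernel_of: "disintegration \<pi> (kernel_of \<pi>)"
  unfolding kernel_of_def using someI[of "disintegration \<pi>", OF disintegration] .

lemma measurable_bary: "(\<lambda>x. mean (\<kappa> x)) \<in> borel_measurable borel"
  by (rule measurable_mean_kernel) measurable

end

section \<open>Bounds on the adapted Wasserstein distance\<close>

text \<open>A simple function below \<open>f\<close> pulls back to a measurable function below \<open>f \<circ> g\<close>. The integral of a
  non-measurable \<open>f\<close> is a supremum over simple functions, and one inequality survives; it serves for the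
  cost that defines the adapted distance.\<close>

lemma nn_integral_distr_le:
  assumes [measurable]: "g \<in> N \<rightarrow>\<^sub>M L"
  shows "(\<integral>\<^sup>+y. f y \<partial>distr N L g) \<le> (\<integral>\<^sup>+x. f (g x) \<partial>N)"
  unfolding nn_integral_def[of "distr N L g"]
proof (rule SUP_least, clarsimp)
  fix s assume s: "simple_function (distr N L g) s" "s \<le> f"
  then have [measurable]: "s \<in> borel_measurable L"
    using borel_measurable_simple_function by fastforce
  have "integral\<^sup>S (distr N L g) s = (\<integral>\<^sup>+x. s (g x) \<partial>N)"
    using s by (simp add: nn_integral_eq_simple_integral[symmetric] nn_integral_distr)
  also have "\<dots> \<le> (\<integral>\<^sup>+x. f (g x) \<partial>N)"
    using s(2) by (intro nn_integral_mono) (auto simp: le_fun_def)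
  finally show "integral\<^sup>S (distr N L g) s \<le> (\<integral>\<^sup>+x. f (g x) \<partial>N)" .
qed

lemma adapted_wasserstein_le_diagonal:
  assumes "\<pi> \<in> couplings \<mu> \<nu>" "\<pi>' \<in> couplings \<mu> \<nu>'"
  shows "adapted_wasserstein 1 \<pi> \<pi>' \<le> (\<integral>\<^sup>+x. wasserstein 1 (kernel_of \<pi> x) (kernel_of \<pi>' x) \<partial>\<mu>)"
proof -
  interpret \<mu>: real_distribution \<mu>
    using couplingsD[OF assms(1)] by simp
  let ?\<theta> = "distr \<mu> (borel \<Otimes>\<^sub>M borel) (\<lambda>x. (x, x))"
  let ?c = "\<lambda>(x, x'). ennreal \<bar>x - x'\<bar> + wasserstein 1 (kernel_of \<pi> x) (kernel_of \<pi>' x')"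
  have m [measurable]: "(\<lambda>x. (x, x)) \<in> \<mu> \<rightarrow>\<^sub>M borel \<Otimes>\<^sub>M borel"
    by measurable
  have "distr \<mu> borel (\<lambda>x. x) = \<mu>"
    by (rule distr_id2) simp
  then have "?\<theta> \<in> couplings \<mu> \<mu>"
    by (auto simp: couplings_def distr_distr comp_def intro!: \<mu>.prob_space_distr)
  then have "adapted_wasserstein 1 \<pi> \<pi>' \<le> (\<integral>\<^sup>+p. ?c p \<partial>?\<theta>)"
    unfolding adapted_wasserstein_one couplingsD(3)[OF assms(1)] couplingsD(3)[OF assms(2)]
    by (rule INF_lower)
  also have "\<dots> \<le> (\<integral>\<^sup>+x. ?c (x, x) \<partial>\<mu>)"
    by (rule nn_integral_distr_le) measurable
  finally show ?thesis
    by simp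
qed

text \<open>The triangle inequality for barycentres: reaching a martingale coupling costs at least the
  displacement of every point to its barycentre, whichever coupling of the first marginals is used.\<close>

lemma (in disintegrated_coupling) adapted_wasserstein_martingale_ge:
  assumes "M \<in> martingale_couplings \<mu> \<nu>'"
  shows "(\<integral>\<^sup>+x. ennreal \<bar>mean (\<kappa> x) - x\<bar> \<partial>\<mu>) \<le> adapted_wasserstein 1 \<pi> M"
proof -
  obtain K where K: "M \<in> couplings \<mu> \<nu>'" "disintegration M K" "AE x in \<mu>. mean (K x) = x"
    using assms by (auto simp: martingale_couplings_def)
  interpret K: disintegrated_coupling \<mu> \<nu>' M K
    using K by unfold_locales
  interpret \<kappa>0: disintegrated_coupling \<mu> \<nu> \<pi> "kernel_of \<pi>"
    using coupling disintegration_kernel_of by unfold_locales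
  interpret K0: disintegrated_coupling \<mu> \<nu>' M "kernel_of M"
    using K K.disintegration_kernel_of by unfold_locales
  have ae: "AE x in \<mu>. mean (kernel_of \<pi> x) = mean (\<kappa> x)"
    using kernel_unique_AE[OF disintegration_kernel_of] by eventually_elim simp
  have ae': "AE x in \<mu>. mean (kernel_of M x) = x"
    using K.kernel_unique_AE[OF K.disintegration_kernel_of] K(3) by eventually_elim simp
  have m [measurable]: "(\<lambda>x. mean (kernel_of \<pi> x)) \<in> borel_measurable borel"
      "(\<lambda>x. mean (kernel_of M x)) \<in> borel_measurable borel"
    by (rule \<kappa>0.measurable_bary K0.measurable_bary)+
  show ?thesis
    unfolding adapted_wasserstein_one couplingsD(3)[OF coupling] couplingsD(3)[OF K(1)]
  proof (rule INF_greatest)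
    fix \<theta> assume \<theta>: "\<theta> \<in> couplings \<mu> \<mu>"
    note sets [measurable_cong] = couplingsD(2)[OF \<theta>]
    note marg = couplingsD(3,4)[OF \<theta>]
    have snd: "snd \<in> \<theta> \<rightarrow>\<^sub>M borel"
      by measurable
    have "AE p in \<theta>. mean (kernel_of M (snd p)) = snd p"
      by (rule AE_distrD[OF snd, of "\<lambda>x. mean (kernel_of M x) = x"]) (simp only: marg ae')
    then have le: "AE p in \<theta>. ennreal \<bar>mean (kernel_of \<pi> (fst p)) - fst p\<bar>
        \<le> (case p of (x, x') \<Rightarrow> ennreal \<bar>x - x'\<bar> + wasserstein 1 (kernel_of \<pi> x) (kernel_of M x'))"
    proof eventually_elim
      case (elim p)
      have "ennreal \<bar>mean (kernel_of \<pi> (fst p)) - fst p\<bar>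
          \<le> ennreal (\<bar>fst p - snd p\<bar> + \<bar>mean (kernel_of \<pi> (fst p)) - mean (kernel_of M (snd p))\<bar>)"
        using elim by (intro ennreal_leI) linarith
      also have "\<dots> = ennreal \<bar>fst p - snd p\<bar>
          + ennreal \<bar>mean (kernel_of \<pi> (fst p)) - mean (kernel_of M (snd p))\<bar>"
        by simp
      also have "\<dots> \<le> ennreal \<bar>fst p - snd p\<bar> + wasserstein 1 (kernel_of \<pi> (fst p)) (kernel_of M (snd p))"
        by (intro add_left_mono wasserstein_ge_mean_diff \<kappa>0.kernel_moment K0.kernel_moment)
      finally show ?case
        by (simp add: split_beta)
    qed
    have "(\<integral>\<^sup>+x. ennreal \<bar>mean (\<kappa> x) - x\<bar> \<partial>\<mu>) = (\<integral>\<^sup>+x. ennreal \<bar>mean (kernel_of \<pi> x) - x\<bar> \<partial>\<mu>)"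
      using ae by (intro nn_integral_cong_AE) (auto elim!: eventually_mono)
    also have "\<dots> = (\<integral>\<^sup>+x. ennreal \<bar>mean (kernel_of \<pi> x) - x\<bar> \<partial>distr \<theta> borel fst)"
      by (simp only: marg)
    also have "\<dots> = (\<integral>\<^sup>+p. ennreal \<bar>mean (kernel_of \<pi> (fst p)) - fst p\<bar> \<partial>\<theta>)"
      by (rule nn_integral_distr) measurable
    also have "\<dots> \<le> (\<integral>\<^sup>+(x, x'). ennreal \<bar>x - x'\<bar> + wasserstein 1 (kernel_of \<pi> x) (kernel_of M x') \<partial>\<theta>)"
      using le by (rule nn_integral_mono_AE)
    finally show "(\<integral>\<^sup>+x. ennreal \<bar>mean (\<kappa> x) - x\<bar> \<partial>\<mu>)
        \<le> (\<integral>\<^sup>+(x, x'). ennreal \<bar>x - x'\<bar> + wasserstein 1 (kernel_of \<pi> x) (kernel_of M x') \<partial>\<theta>)" .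
  qed
qed


section \<open>Monotone transport of diffuse measures on the unit interval\<close>

text \<open>Continuity of the distribution function, that is absence of atoms, makes \<open>left_inverse\<close> an exact right
  inverse of it up to the total mass.\<close>

locale diffuse_unit_measure = finite_borel_measure L for L :: "real measure" +
  assumes diffuse: "measure L {x} = 0"
    and AE_unit: "AE x in L. x \<in> {0<..<1}"
begin

lemma cdf_isCont: "isCont (cdf L) x"
  by (simp add: isCont_cdf diffuse)

lemma cdf_continuous_on: "continuous_on S (cdf L)"
  by (simp add: cdf_isCont continuous_at_imp_continuous_on)

lemma cdf_measurable [measurable]: "cdf L \<in> borel_measurable borel"
  using cdf_continuous_on by (rule borel_measurable_continuous_onI)

lemma cdf_nonpos: "x \<le> 0 \<Longrightarrow> cdf L x = 0"
proof -
  assume x: "x \<le> 0"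
  have "AE u in L. u \<in> {..x} \<longleftrightarrow> u \<in> {}"
    using AE_unit by eventually_elim (use x in auto)
  then have "emeasure L {..x} = emeasure L {}"
    by (intro emeasure_eq_AE) (auto simp: M_is_borel)
  then show ?thesis
    by (simp add: cdf_def measure_def)
qed

lemma cdf_ge_one: "1 \<le> x \<Longrightarrow> cdf L x = measure L UNIV"
proof -
  assume x: "1 \<le> x"
  have "AE u in L. u \<in> {..x} \<longleftrightarrow> u \<in> UNIV"
    using AE_unit by eventually_elim (use x in auto)
  then have "emeasure L {..x} = emeasure L UNIV"
    by (intro emeasure_eq_AE) (auto simp: M_is_borel)
  then show ?thesis
    by (simp add: cdf_def measure_def)
qed

lemma cdf_le_total: "cdf L x \<le> measure L UNIV"
  using cdf_bounded by (simp add: borel_UNIV)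

lemma left_inverse_mem:
  assumes "w \<le> measure L UNIV"
  shows "left_inverse (cdf L) w \<in> {r \<in> {0..1}. w \<le> cdf L r}"
proof -
  have "closed {r. w \<le> cdf L r}"
    by (intro closed_Collect_le continuous_intros cdf_continuous_on)
  then have "closed ({0..1} \<inter> {r. w \<le> cdf L r})"
    by (intro closed_Int) auto
  moreover have "1 \<in> {0..1} \<inter> {r. w \<le> cdf L r}"
    using assms cdf_ge_one by simp
  then have "{0..1} \<inter> {r. w \<le> cdf L r} \<noteq> {}"
    by blast
  ultimately have "Inf ({0..1} \<inter> {r. w \<le> cdf L r}) \<in> {0..1} \<inter> {r. w \<le> cdf L r}"
    by (intro closed_contains_Inf) (auto intro!: bdd_belowI[of _ 0])
  moreover have "{r \<in> {0..1}. w \<le> cdf L r} = {0..1} \<inter> {r. w \<le> cdf L r}"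
    by blast
  ultimately show ?thesis
    unfolding left_inverse_def by (simp only:)
qed

lemma left_inverse_le_iff:
  assumes "w \<le> measure L UNIV" "r \<in> {0..1}"
  shows "left_inverse (cdf L) w \<le> r \<longleftrightarrow> w \<le> cdf L r"
proof
  assume "left_inverse (cdf L) w \<le> r"
  then show "w \<le> cdf L r"
    using left_inverse_mem[OF assms(1)] cdf_nondecreasing order_trans by blast
next
  assume "w \<le> cdf L r"
  then show "left_inverse (cdf L) w \<le> r"
    unfolding left_inverse_def using assms(2)
    by (intro cInf_lower) (auto intro!: bdd_belowI[of _ 0])
qed

lemma cdf_attains:
  assumes "0 \<le> w" "w \<le> cdf L b" "0 \<le> b"
  obtains r where "0 \<le> r" "r \<le> b" "cdf L r = w"
  using IVT'[of "cdf L" 0 w b] assms cdf_nonpos cdf_continuous_on by auto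

lemma cdf_left_inverse:
  assumes "0 \<le> w" "w \<le> measure L UNIV"
  shows "cdf L (left_inverse (cdf L) w) = w"
proof -
  define l where "l = left_inverse (cdf L) w"
  have l: "0 \<le> l" "l \<le> 1" "w \<le> cdf L l"
    using left_inverse_mem[OF assms(2)] by (auto simp: l_def)
  obtain r where r: "0 \<le> r" "r \<le> l" "cdf L r = w"
    using cdf_attains assms(1) l by metis
  have "l \<le> r"
    unfolding l_def using r l by (subst left_inverse_le_iff[OF assms(2)]) auto
  with r show ?thesis
    by (simp add: l_def)
qed

text \<open>Above the total mass \<open>left_inverse\<close> is the infimum of the empty set; truncation at the total mass
  leaves a monotone function.\<close>

lemma left_inverse_measurable:
  "(\<lambda>u. left_inverse (cdf L) (min (measure L UNIV) u)) \<in> borel_measurable borel"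
proof (rule borel_measurable_mono, rule monoI)
  fix u v :: real assume "u \<le> v"
  then have "min (measure L UNIV) u \<le> cdf L (left_inverse (cdf L) (min (measure L UNIV) v))"
    using left_inverse_mem[of "min (measure L UNIV) v"] by auto
  then show "left_inverse (cdf L) (min (measure L UNIV) u) \<le> left_inverse (cdf L) (min (measure L UNIV) v)"
    using left_inverse_mem[of "min (measure L UNIV) v"] by (subst left_inverse_le_iff) auto
qed

end

text \<open>The monotone rearrangement of one measure onto the other: its sublevel sets are, up to a null
  set, the half-lines \<open>{..s}\<close> whose mass is prescribed by the target.\<close>

locale diffuse_unit_pair = L: diffuse_unit_measure L + L': diffuse_unit_measure L'
  for L L' :: "real measure" +
  assumes mass_eq: "measure L UNIV = measure L' UNIV"
begin

definition rearrangement :: "real \<Rightarrow> real" where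
  "rearrangement u = left_inverse (cdf L') (cdf L u)"

lemma cdf_le_target: "cdf L u \<le> measure L' UNIV"
  using L.cdf_le_total mass_eq by simp

lemma rearrangement_measurable [measurable]: "rearrangement \<in> borel_measurable borel"
proof -
  have "rearrangement = (\<lambda>u. left_inverse (cdf L') (min (measure L' UNIV) (cdf L u)))"
    using cdf_le_target by (simp add: rearrangement_def[abs_def] min_absorb2)
  with measurable_compose[OF L.cdf_measurable L'.left_inverse_measurable] show ?thesis
    by simp
qed

lemma distr_rearrangement: "distr L borel rearrangement = L'"
proof (rule cdf_unique')
  have m [measurable]: "rearrangement \<in> L \<rightarrow>\<^sub>M borel"
    using rearrangement_measurable by (simp cong: measurable_cong_sets add: L.M_is_borel)
  interpret d: finite_measure "distr L borel rearrangement"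
    by (rule L.finite_measure_distr) measurable
  show "finite_borel_measure (distr L borel rearrangement)"
    by unfold_locales simp
  show "finite_borel_measure L'" ..
  show "cdf (distr L borel rearrangement) = cdf L'"
  proof
    fix r
    have range: "rearrangement u \<in> {0..1}" for u
      using L'.left_inverse_mem[OF cdf_le_target[of u]] by (simp add: rearrangement_def)
    have cdf: "cdf (distr L borel rearrangement) r = measure L {u. rearrangement u \<le> r}"
      unfolding cdf_def by (subst measure_distr) (auto simp: L.borel_UNIV vimage_def)
    consider "r < 0" | "r \<in> {0..<1}" | "1 \<le> r"
      by fastforce
    then show "cdf (distr L borel rearrangement) r = cdf L' r"
    proof cases
      case 1
      then have "{u. rearrangement u \<le> r} = {}"
        using range by (auto simp: not_le intro: less_le_trans)
      with 1 show ?thesis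
        by (simp add: cdf L'.cdf_nonpos)
    next
      case 2
      define c where "c = cdf L' r"
      have sub: "{u. rearrangement u \<le> r} = {u. cdf L u \<le> c}"
        using 2 cdf_le_target by (auto simp: rearrangement_def L'.left_inverse_le_iff c_def)
      define S where "S = {0..1} \<inter> {s. cdf L s \<le> c}"
      have "closed S"
        unfolding S_def by (intro closed_Int closed_Collect_le continuous_intros L.cdf_continuous_on)
      obtain s' where s': "0 \<le> s'" "s' \<le> 1" "cdf L s' = c"
        using L.cdf_attains[of c 1] L.cdf_ge_one L'.cdf_le_total L'.cdf_nonneg mass_eq
        by (metis c_def order_refl zero_le_one)
      have bdd: "bdd_above S"
        by (auto simp: S_def intro!: bdd_aboveI[of _ 1])
      have ne: "s' \<in> S"
        using s' by (auto simp: S_def)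
      have s: "Sup S \<in> S"
        using \<open>closed S\<close> ne bdd by (intro closed_contains_Sup) auto
      have "AE u in L. cdf L u \<le> c \<longleftrightarrow> u \<le> Sup S"
        using L.AE_unit
      proof eventually_elim
        case (elim u)
        have "u \<le> Sup S" if "cdf L u \<le> c"
          using that elim bdd by (intro cSup_upper) (auto simp: S_def)
        moreover have "cdf L u \<le> c" if "u \<le> Sup S"
          using that s L.cdf_nondecreasing by (auto simp: S_def intro: order_trans)
        ultimately show ?case by blast
      qed
      then have "measure L {u. cdf L u \<le> c} = measure L {..Sup S}"
        unfolding measure_def
        by (intro arg_cong[where f=enn2real] emeasure_eq_AE) (auto simp: L.M_is_borel)
      also have "\<dots> = cdf L (Sup S)"
        by (simp add: cdf_def)
      also have "\<dots> = c"
        using s s' L.cdf_nondecreasing[OF cSup_upper[OF ne bdd]] by (auto simp: S_def)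
      finally show ?thesis
        by (simp add: cdf sub c_def)
    next
      case 3
      then have "{u. rearrangement u \<le> r} = UNIV"
        using range by (auto intro: order_trans)
      with 3 show ?thesis
        by (simp add: cdf L'.cdf_ge_one mass_eq)
    qed
  qed
qed

end

text \<open>The rearrangement of a measure onto itself lies below the identity and has the same mean as
  the identity.\<close>

lemma (in diffuse_unit_measure) left_inverse_cdf_AE:
  "AE u in L. left_inverse (cdf L) (cdf L u) = u"
proof -
  interpret diffuse_unit_pair L L
    by unfold_locales simp
  have m: "rearrangement \<in> L \<rightarrow>\<^sub>M borel"
    using rearrangement_measurable by (simp cong: measurable_cong_sets add: M_is_borel)
  have id: "(\<lambda>x. x) \<in> borel_measurable L"
    by (simp cong: measurable_cong_sets add: M_is_borel)
  have range: "rearrangement u \<in> {0..1}" for u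
    using left_inverse_mem[OF cdf_le_total[of u]] by (simp add: rearrangement_def)
  have le: "AE u in L. rearrangement u \<le> u"
    using AE_unit
    by eventually_elim (simp add: rearrangement_def left_inverse_le_iff cdf_le_total)
  have "AE u in L. norm u \<le> 1"
    using AE_unit by eventually_elim auto
  then have int: "integrable L rearrangement" "integrable L (\<lambda>u. u)"
    using range m id by (auto intro!: integrable_const_bound[where B=1])
  have "(\<integral>u. rearrangement u \<partial>L) = (\<integral>u. u \<partial>distr L borel rearrangement)"
    by (rule integral_distr[OF m, symmetric]) simp
  also have "\<dots> = (\<integral>u. u \<partial>L)"
    by (simp only: distr_rearrangement)
  finally have "(\<integral>u. u - rearrangement u \<partial>L) = 0"
    using int by simp
  then have "AE u in L. u - rearrangement u = 0"
    using le int by (subst (asm) integral_nonneg_eq_0_iff_AE) (auto elim!: eventually_mono)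
  then show ?thesis
    by eventually_elim (simp add: rearrangement_def)
qed

lemma (in diffuse_unit_pair) rearrangement_inverse_AE:
  "AE u in L. left_inverse (cdf L) (cdf L' (rearrangement u)) = u"
  using L.left_inverse_cdf_AE
  by eventually_elim (simp add: rearrangement_def L'.cdf_left_inverse cdf_le_target L.cdf_nonneg)

locale unit_density =
  fixes f :: "real \<Rightarrow> real"
  assumes f_measurable [measurable]: "f \<in> borel_measurable borel"
    and f_nonneg: "0 \<le> f u"
    and f_integrable: "set_integrable lborel {0<..<1} f"
begin

definition unit_measure :: "real measure" where
  "unit_measure = density lborel (\<lambda>u. ennreal (indicator {0<..<1} u * f u))"

lemma unit_measure_borel: "sets unit_measure = sets borel"
  by (simp add: unit_measure_def)

lemma emeasure_unit_measure:
  assumes "A \<in> sets borel"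
  shows "emeasure unit_measure A = ennreal (LINT u:A \<inter> {0<..<1}|lborel. f u)"
proof -
  have "emeasure unit_measure A = (\<integral>\<^sup>+u. ennreal (indicator {0<..<1} u * f u) * indicator A u \<partial>lborel)"
    unfolding unit_measure_def using assms by (subst emeasure_density) auto
  also have "\<dots> = (\<integral>\<^sup>+u. ennreal (indicator (A \<inter> {0<..<1}) u * f u) \<partial>lborel)"
    by (intro nn_integral_cong) (auto simp: indicator_def)
  also have "\<dots> = ennreal (LINT u:A \<inter> {0<..<1}|lborel. f u)"
    using set_integrable_subset[OF f_integrable, of "A \<inter> {0<..<1}"] assms f_nonneg
    unfolding set_lebesgue_integral_def set_integrable_def
    by (subst nn_integral_eq_integral) auto
  finally show ?thesis .
qed

lemma measure_unit_measure:
  assumes "A \<in> sets borel"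
  shows "measure unit_measure A = (LINT u:A \<inter> {0<..<1}|lborel. f u)"
  using emeasure_unit_measure[OF assms] f_nonneg
  by (auto simp: measure_def set_lebesgue_integral_def intro!: integral_nonneg_AE)

lemma AE_unit_measure_iff:
  assumes "Measurable.pred borel P"
  shows "(AE u in unit_measure. P u) \<longleftrightarrow> (AE u in lborel. u \<in> {0<..<1} \<longrightarrow> 0 < f u \<longrightarrow> P u)"
  unfolding unit_measure_def
  by (subst AE_density) (auto simp: indicator_def intro!: AE_cong)

lemma AE_unit_measureD:
  assumes "AE u in unit_measure. P u"
  shows "AE u in uniform01. 0 < f u \<longrightarrow> P u"
  using assms unfolding unit_measure_def
  by (subst (asm) AE_density)
     (auto simp: AE_restrict_space_iff indicator_def elim!: eventually_mono)

sublocale diffuse_unit_measure unit_measure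
proof -
  have fin: "finite_measure unit_measure"
    using emeasure_unit_measure[of UNIV]
    by (intro finite_measureI) (simp add: unit_measure_def)
  have null: "measure unit_measure {x} = 0" for x
  proof -
    have "emeasure unit_measure {x} = 0"
      unfolding unit_measure_def
      by (subst emeasure_density) (auto simp: nn_integral_null_set)
    then show ?thesis by (simp add: measure_def)
  qed
  have ae: "AE x in unit_measure. x \<in> {0<..<1}"
    by (subst AE_unit_measure_iff) auto
  show "diffuse_unit_measure unit_measure"
    using fin null ae unit_measure_borel
    unfolding diffuse_unit_measure_def diffuse_unit_measure_axioms_def
      finite_borel_measure_def finite_borel_measure_axioms_def by blast
qed

lemma cdf_unit_measure:
  assumes "u \<in> {0..1}"
  shows "cdf unit_measure u = (LINT v:{0<..<u}|lborel. f v)"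
proof -
  have "cdf unit_measure u = (LINT v:{..u} \<inter> {0<..<1}|lborel. f v)"
    by (simp add: cdf_def measure_unit_measure)
  also have "\<dots> = (LINT v:{0<..<u}|lborel. f v)"
    unfolding set_lebesgue_integral_def using AE_lborel_singleton[of u] assms
    by (intro integral_cong_AE) (auto elim!: eventually_mono simp: indicator_def)
  finally show ?thesis .
qed

lemma nn_integral_unit_measure:
  assumes [measurable]: "h \<in> borel_measurable borel"
  shows "(\<integral>\<^sup>+u. h u \<partial>unit_measure) = (\<integral>\<^sup>+u. ennreal (f u) * h u \<partial>uniform01)"
proof -
  have "(\<integral>\<^sup>+u. h u \<partial>unit_measure) = (\<integral>\<^sup>+u. ennreal (indicator {0<..<1} u * f u) * h u \<partial>lborel)"
    unfolding unit_measure_def by (subst nn_integral_density) auto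
  also have "\<dots> = (\<integral>\<^sup>+u. ennreal (f u) * h u * indicator {0<..<1} u \<partial>lborel)"
    by (intro nn_integral_cong) (auto simp: indicator_def)
  finally show ?thesis
    by (simp add: nn_integral_restrict_space)
qed

end

lemma left_inverse_cong:
  assumes "\<And>r. r \<in> {0..1} \<Longrightarrow> D r = E r"
  shows "left_inverse D w = left_inverse E w"
  unfolding left_inverse_def using assms by (intro arg_cong[where f=Inf]) auto


section \<open>The pairing of quantile levels\<close>

locale dispersed_coupling = disintegrated_coupling +
  assumes \<mu>_moment: "\<mu> \<in> finite_moment 1"
    and \<nu>_moment: "\<nu> \<in> finite_moment 1"
    and mean_eq: "mean \<mu> = mean \<nu>"
    and dispersion: "barycentre_dispersion \<mu> \<kappa>"
begin

lemma quantile_measurable: "quantile \<mu> \<in> borel_measurable borel"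
  by (rule \<mu>.measurable_quantile)

lemma kernel_quantile_measurable [measurable]: "(\<lambda>u. \<kappa> (quantile \<mu> u)) \<in> borel \<rightarrow>\<^sub>M prob_algebra borel"
  by (rule measurable_compose[OF quantile_measurable kernel_measurable])

lemma bary_measurable [measurable]: "bary \<mu> \<kappa> \<in> borel_measurable borel"
  unfolding bary_def[abs_def] by (rule measurable_mean_kernel[OF kernel_quantile_measurable])

lemma integrable_barycentre: "integrable \<mu> (\<lambda>x. mean (\<kappa> x))"
  and integral_barycentre: "(\<integral>x. mean (\<kappa> x) \<partial>\<mu>) = mean \<nu>"
proof -
  have "\<kappa> \<in> \<mu> \<rightarrow>\<^sub>M prob_algebra borel"
    by (rule k_measurable)
  from mean_bind[OF \<mu>.prob_space_axioms this] \<nu>_moment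
  show "integrable \<mu> (\<lambda>x. mean (\<kappa> x))" "(\<integral>x. mean (\<kappa> x) \<partial>\<mu>) = mean \<nu>"
    by (simp_all flip: second_marginal_eq)
qed

lemma integral_quantile:
  fixes h :: "real \<Rightarrow> real"
  assumes "h \<in> borel_measurable borel"
  shows "(\<integral>u. h (quantile \<mu> u) \<partial>uniform01) = (\<integral>x. h x \<partial>\<mu>)"
  using integral_distr[OF \<mu>.measurable_quantile_uniform01 assms]
  unfolding \<mu>.distr_quantile by (rule sym)

lemma integrable_quantile:
  fixes h :: "real \<Rightarrow> real"
  assumes "integrable \<mu> h"
  shows "integrable uniform01 (\<lambda>u. h (quantile \<mu> u))"
  using integrable_distr[OF \<mu>.measurable_quantile_uniform01, of h] assms
  unfolding \<mu>.distr_quantile by blast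

lemma nn_integral_quantile:
  assumes "h \<in> borel_measurable borel"
  shows "(\<integral>\<^sup>+u. h (quantile \<mu> u) \<partial>uniform01) = (\<integral>\<^sup>+x. h x \<partial>\<mu>)"
  using nn_integral_distr[OF \<mu>.measurable_quantile_uniform01, of h] \<mu>.measurable_finite_borel[OF assms]
  unfolding \<mu>.distr_quantile by simp

definition gap :: "real \<Rightarrow> real" where
  "gap u = quantile \<mu> u - bary \<mu> \<kappa> u"

lemma gap_measurable [measurable]: "gap \<in> borel_measurable borel"
  unfolding gap_def[abs_def] by measurable

lemma integrable_quantile_id: "integrable uniform01 (quantile \<mu>)"
  using integrable_quantile[OF finite_moment_integrable[OF \<mu>_moment]] .

lemma integrable_bary: "integrable uniform01 (bary \<mu> \<kappa>)"
  unfolding bary_def[abs_def] using integrable_quantile[OF integrable_barycentre] .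

lemma integrable_gap: "integrable uniform01 gap"
  unfolding gap_def[abs_def]
  by (rule Bochner_Integration.integrable_diff[OF integrable_quantile_id integrable_bary])

lemma integral_gap: "(\<integral>u. gap u \<partial>uniform01) = 0"
proof -
  have "(\<integral>u. gap u \<partial>uniform01) = (\<integral>u. quantile \<mu> u \<partial>uniform01) - (\<integral>u. bary \<mu> \<kappa> u \<partial>uniform01)"
    unfolding gap_def[abs_def]
    by (rule Bochner_Integration.integral_diff[OF integrable_quantile_id integrable_bary])
  also have "(\<integral>u. quantile \<mu> u \<partial>uniform01) = mean \<mu>"
    using integral_quantile[of "\<lambda>x. x"] by (simp add: mean_def)
  also have "(\<integral>u. bary \<mu> \<kappa> u \<partial>uniform01) = mean \<nu>"
    unfolding bary_def integral_quantile[OF measurable_bary] by (rule integral_barycentre)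
  finally show ?thesis
    by (simp add: mean_eq)
qed

definition excess :: "real \<Rightarrow> real" where
  "excess u = max 0 (gap u)"

definition deficit :: "real \<Rightarrow> real" where
  "deficit u = max 0 (- gap u)"

lemma gap_eq: "gap u = excess u - deficit u"
  by (simp add: excess_def deficit_def)

lemma excess_measurable [measurable]: "excess \<in> borel_measurable borel"
  and deficit_measurable [measurable]: "deficit \<in> borel_measurable borel"
  unfolding excess_def[abs_def] deficit_def[abs_def] by measurable

lemma integrable_excess: "integrable uniform01 excess"
  and integrable_deficit: "integrable uniform01 deficit"
  unfolding excess_def[abs_def] deficit_def[abs_def] using integrable_gap by auto

lemma U_plus_eq: "U_plus \<mu> \<kappa> = {u \<in> {0<..<1}. 0 < excess u}"
  and U_minus_eq: "U_minus \<mu> \<kappa> = {u \<in> {0<..<1}. 0 < deficit u}"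
  by (auto simp: U_plus_def U_minus_def excess_def deficit_def gap_def)

lemma set_integrable_uniform01:
  fixes h :: "real \<Rightarrow> real"
  shows "integrable uniform01 h \<longleftrightarrow> set_integrable lborel {0<..<1} h"
  by (simp add: integrable_restrict_space set_integrable_def)

lemma set_integral_uniform01:
  fixes h :: "real \<Rightarrow> real"
  shows "(\<integral>u. h u \<partial>uniform01) = (LINT u:{0<..<1}|lborel. h u)"
  by (simp add: integral_restrict_space set_lebesgue_integral_def)

lemma unit_density_excess: "unit_density excess"
proof
  show "0 \<le> excess u" for u
    by (simp add: excess_def)
qed (use integrable_excess in \<open>simp_all only: excess_measurable set_integrable_uniform01\<close>)

lemma unit_density_deficit: "unit_density deficit"
proof
  show "0 \<le> deficit u" for u
    by (simp add: deficit_def)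
qed (use integrable_deficit in \<open>simp_all only: deficit_measurable set_integrable_uniform01\<close>)

sublocale ex: unit_density excess
  by (rule unit_density_excess)

sublocale de: unit_density deficit
  by (rule unit_density_deficit)

lemma mass_eq: "measure ex.unit_measure UNIV = measure de.unit_measure UNIV"
proof -
  have "(\<integral>u. excess u \<partial>uniform01) - (\<integral>u. deficit u \<partial>uniform01) = 0"
    using integral_gap Bochner_Integration.integral_diff[OF integrable_excess integrable_deficit]
    unfolding gap_eq by linarith
  then show ?thesis
    by (simp add: ex.measure_unit_measure de.measure_unit_measure set_integral_uniform01)
qed

sublocale ed: diffuse_unit_pair ex.unit_measure de.unit_measure
  by unfold_locales (rule mass_eq)

sublocale de_ex: diffuse_unit_pair de.unit_measure ex.unit_measure
  by unfold_locales (rule mass_eq[symmetric])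

lemma Delta_plus_eq: "r \<in> {0..1} \<Longrightarrow> Delta_plus \<mu> \<kappa> r = cdf ex.unit_measure r"
  and Delta_minus_eq: "r \<in> {0..1} \<Longrightarrow> Delta_minus \<mu> \<kappa> r = cdf de.unit_measure r"
  by (simp_all add: ex.cdf_unit_measure de.cdf_unit_measure Delta_plus_def Delta_minus_def
      excess_def deficit_def gap_def)

lemma phi_U_plus: "u \<in> U_plus \<mu> \<kappa> \<Longrightarrow> phi \<mu> \<kappa> u = ed.rearrangement u"
proof -
  assume u: "u \<in> U_plus \<mu> \<kappa>"
  then have "phi \<mu> \<kappa> u = left_inverse (Delta_minus \<mu> \<kappa>) (Delta_plus \<mu> \<kappa> u)"
    by (simp add: phi_def)
  also have "\<dots> = left_inverse (cdf de.unit_measure) (cdf ex.unit_measure u)"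
    using u Delta_plus_eq[of u] left_inverse_cong[OF Delta_minus_eq] by (simp add: U_plus_eq)
  finally show ?thesis
    by (simp add: ed.rearrangement_def)
qed

lemma phi_U_minus: "u \<in> U_minus \<mu> \<kappa> \<Longrightarrow> phi \<mu> \<kappa> u = de_ex.rearrangement u"
proof -
  assume u: "u \<in> U_minus \<mu> \<kappa>"
  then have "u \<notin> U_plus \<mu> \<kappa>"
    by (simp add: U_minus_def U_plus_def)
  with u have "phi \<mu> \<kappa> u = left_inverse (Delta_plus \<mu> \<kappa>) (Delta_minus \<mu> \<kappa> u)"
    by (simp add: phi_def)
  also have "\<dots> = left_inverse (cdf ex.unit_measure) (cdf de.unit_measure u)"
    using u Delta_minus_eq[of u] left_inverse_cong[OF Delta_plus_eq] by (simp add: U_minus_eq)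
  finally show ?thesis
    by (simp add: de_ex.rearrangement_def)
qed

lemma U_sets [measurable]: "U_plus \<mu> \<kappa> \<in> sets borel" "U_minus \<mu> \<kappa> \<in> sets borel"
  unfolding U_plus_eq U_minus_eq by measurable

lemma U_disjoint: "u \<in> U_plus \<mu> \<kappa> \<Longrightarrow> u \<notin> U_minus \<mu> \<kappa>"
  by (auto simp: U_plus_def U_minus_def)

lemma phi_measurable [measurable]: "phi \<mu> \<kappa> \<in> borel_measurable borel"
proof -
  have "phi \<mu> \<kappa> = (\<lambda>u. if u \<in> U_plus \<mu> \<kappa> then ed.rearrangement u
      else if u \<in> U_minus \<mu> \<kappa> then de_ex.rearrangement u else u)"
  proof
    fix u
    show "phi \<mu> \<kappa> u = (if u \<in> U_plus \<mu> \<kappa> then ed.rearrangement u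
      else if u \<in> U_minus \<mu> \<kappa> then de_ex.rearrangement u else u)"
      using phi_U_plus[of u] phi_U_minus[of u] by (auto simp: phi_def)
  qed
  moreover have "\<dots> \<in> borel_measurable borel"
    by measurable
  ultimately show ?thesis
    by simp
qed

lemma p_weight_eq:
  assumes "u \<in> U_plus \<mu> \<kappa>" "phi \<mu> \<kappa> u \<in> U_minus \<mu> \<kappa>"
  shows "p_weight \<mu> \<kappa> u = deficit (phi \<mu> \<kappa> u) / (excess u + deficit (phi \<mu> \<kappa> u))"
  using assms by (simp add: p_weight_def Let_def U_plus_def U_minus_def excess_def deficit_def gap_def)

lemma p_weight_eq':
  assumes "u \<in> U_minus \<mu> \<kappa>" "phi \<mu> \<kappa> u \<in> U_plus \<mu> \<kappa>"
  shows "p_weight \<mu> \<kappa> u = excess (phi \<mu> \<kappa> u) / (deficit u + excess (phi \<mu> \<kappa> u))"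
proof -
  have "p_weight \<mu> \<kappa> u = (- excess (phi \<mu> \<kappa> u)) / (- (deficit u + excess (phi \<mu> \<kappa> u)))"
    using assms by (simp add: p_weight_def Let_def U_plus_def U_minus_def excess_def deficit_def gap_def)
  then show ?thesis
    by (simp only: minus_divide_divide)
qed

text \<open>When \<open>\<phi>\<close> exchanges \<open>u\<close> and \<open>w\<close>, both weights have the denominator \<open>excess + deficit\<close> of the pair,
  and their numerators are its two summands.\<close>

lemma A_plus_eq:
  "A_plus \<mu> \<kappa> = {u \<in> U_plus \<mu> \<kappa>. phi \<mu> \<kappa> u \<in> U_minus \<mu> \<kappa> \<and> phi \<mu> \<kappa> (phi \<mu> \<kappa> u) = u}"
proof -
  have "p_weight \<mu> \<kappa> (phi \<mu> \<kappa> u) = 1 - p_weight \<mu> \<kappa> u"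
    if "u \<in> U_plus \<mu> \<kappa>" "phi \<mu> \<kappa> u \<in> U_minus \<mu> \<kappa>" "phi \<mu> \<kappa> (phi \<mu> \<kappa> u) = u" for u
    using that by (simp add: p_weight_eq p_weight_eq') (simp add: U_plus_eq U_minus_eq field_simps)
  then show ?thesis
    by (auto simp: A_plus_def)
qed

lemma A_minus_eq:
  "A_minus \<mu> \<kappa> = {u \<in> U_minus \<mu> \<kappa>. phi \<mu> \<kappa> u \<in> U_plus \<mu> \<kappa> \<and> phi \<mu> \<kappa> (phi \<mu> \<kappa> u) = u}"
proof -
  have "p_weight \<mu> \<kappa> (phi \<mu> \<kappa> u) = 1 - p_weight \<mu> \<kappa> u"
    if "u \<in> U_minus \<mu> \<kappa>" "phi \<mu> \<kappa> u \<in> U_plus \<mu> \<kappa>" "phi \<mu> \<kappa> (phi \<mu> \<kappa> u) = u" for u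
    using that by (simp add: p_weight_eq p_weight_eq') (simp add: U_plus_eq U_minus_eq field_simps)
  then show ?thesis
    by (auto simp: A_minus_def)
qed

lemma A_sets [measurable]: "A_plus \<mu> \<kappa> \<in> sets borel" "A_minus \<mu> \<kappa> \<in> sets borel"
proof -
  have "A_plus \<mu> \<kappa> = {u \<in> space borel. u \<in> U_plus \<mu> \<kappa> \<and> phi \<mu> \<kappa> u \<in> U_minus \<mu> \<kappa> \<and> phi \<mu> \<kappa> (phi \<mu> \<kappa> u) = u}"
    by (auto simp: A_plus_eq)
  also have "\<dots> \<in> sets borel"
    by measurable
  finally show "A_plus \<mu> \<kappa> \<in> sets borel" .
  have "A_minus \<mu> \<kappa> = {u \<in> space borel. u \<in> U_minus \<mu> \<kappa> \<and> phi \<mu> \<kappa> u \<in> U_plus \<mu> \<kappa> \<and> phi \<mu> \<kappa> (phi \<mu> \<kappa> u) = u}"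
    by (auto simp: A_minus_eq)
  also have "\<dots> \<in> sets borel"
    by measurable
  finally show "A_minus \<mu> \<kappa> \<in> sets borel" .
qed

lemma phi_A_plus: "u \<in> A_plus \<mu> \<kappa> \<Longrightarrow> phi \<mu> \<kappa> u \<in> A_minus \<mu> \<kappa>"
  and phi_A_minus: "u \<in> A_minus \<mu> \<kappa> \<Longrightarrow> phi \<mu> \<kappa> u \<in> A_plus \<mu> \<kappa>"
  by (auto simp: A_plus_eq A_minus_eq)

lemma phi_phi: "u \<in> A_plus \<mu> \<kappa> \<Longrightarrow> phi \<mu> \<kappa> (phi \<mu> \<kappa> u) = u"
  "u \<in> A_minus \<mu> \<kappa> \<Longrightarrow> phi \<mu> \<kappa> (phi \<mu> \<kappa> u) = u"
  by (auto simp: A_plus_eq A_minus_eq)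

text \<open>The deficit measure charges only \<open>U_minus\<close> and is the image of the excess measure, so \<open>\<phi>\<close> maps almost
  every level of \<open>U_plus\<close> into \<open>U_minus\<close>; and \<open>\<phi>(\<phi>(u)) = u\<close> since \<open>\<Delta>\<^sub>-\<close> undoes its left
  inverse and \<open>\<Delta>\<^sub>+\<close> is undone by its own almost everywhere.\<close>

lemma AE_A_plus: "AE u in uniform01. u \<in> U_plus \<mu> \<kappa> \<longrightarrow> u \<in> A_plus \<mu> \<kappa>"
proof -
  have m: "ed.rearrangement \<in> ex.unit_measure \<rightarrow>\<^sub>M borel"
    using ed.rearrangement_measurable by (simp cong: measurable_cong_sets add: ex.unit_measure_borel)
  have "AE v in distr ex.unit_measure borel ed.rearrangement. v \<in> U_minus \<mu> \<kappa>"
    unfolding ed.distr_rearrangement by (subst de.AE_unit_measure_iff) (auto simp: U_minus_eq)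
  then have "AE u in ex.unit_measure. ed.rearrangement u \<in> U_minus \<mu> \<kappa>"
    by (rule AE_distrD[OF m])
  then have "AE u in ex.unit_measure. u \<in> U_plus \<mu> \<kappa> \<longrightarrow> u \<in> A_plus \<mu> \<kappa>"
    using ed.rearrangement_inverse_AE
    by eventually_elim (auto simp: A_plus_eq phi_U_plus phi_U_minus de_ex.rearrangement_def)
  then have "AE u in uniform01. 0 < excess u \<longrightarrow> u \<in> U_plus \<mu> \<kappa> \<longrightarrow> u \<in> A_plus \<mu> \<kappa>"
    by (rule ex.AE_unit_measureD)
  then show ?thesis
    by eventually_elim (auto simp: U_plus_eq)
qed

lemma AE_A_minus: "AE u in uniform01. u \<in> U_minus \<mu> \<kappa> \<longrightarrow> u \<in> A_minus \<mu> \<kappa>"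
proof -
  have m: "de_ex.rearrangement \<in> de.unit_measure \<rightarrow>\<^sub>M borel"
    using de_ex.rearrangement_measurable by (simp cong: measurable_cong_sets add: de.unit_measure_borel)
  have "AE v in distr de.unit_measure borel de_ex.rearrangement. v \<in> U_plus \<mu> \<kappa>"
    unfolding de_ex.distr_rearrangement by (subst ex.AE_unit_measure_iff) (auto simp: U_plus_eq)
  then have "AE u in de.unit_measure. de_ex.rearrangement u \<in> U_plus \<mu> \<kappa>"
    by (rule AE_distrD[OF m])
  then have "AE u in de.unit_measure. u \<in> U_minus \<mu> \<kappa> \<longrightarrow> u \<in> A_minus \<mu> \<kappa>"
    using de_ex.rearrangement_inverse_AE
    by eventually_elim (auto simp: A_minus_eq phi_U_plus phi_U_minus ed.rearrangement_def)
  then have "AE u in uniform01. 0 < deficit u \<longrightarrow> u \<in> U_minus \<mu> \<kappa> \<longrightarrow> u \<in> A_minus \<mu> \<kappa>"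
    by (rule de.AE_unit_measureD)
  then show ?thesis
    by eventually_elim (auto simp: U_minus_eq)
qed

text \<open>Change of variables \<open>v = \<phi>(u)\<close>: divide by the density of the deficit measure, transport to the
  excess measure and multiply by its density. Off \<open>U_plus\<close> the factor \<open>excess u\<close> vanishes.\<close>

lemma nn_integral_deficit:
  assumes [measurable]: "h \<in> borel_measurable borel" and h: "\<And>v. 0 \<le> h v"
  shows "(\<integral>\<^sup>+v. ennreal (h v) * indicator (U_minus \<mu> \<kappa>) v \<partial>uniform01)
    = (\<integral>\<^sup>+u. ennreal (excess u * (h (ed.rearrangement u) / deficit (ed.rearrangement u))) \<partial>uniform01)"
proof -
  have m: "ed.rearrangement \<in> ex.unit_measure \<rightarrow>\<^sub>M borel"
    using ed.rearrangement_measurable by (simp cong: measurable_cong_sets add: ex.unit_measure_borel)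
  have "(\<integral>\<^sup>+v. ennreal (h v) * indicator (U_minus \<mu> \<kappa>) v \<partial>uniform01)
      = (\<integral>\<^sup>+v. ennreal (deficit v) * ennreal (h v / deficit v) \<partial>uniform01)"
    using h de.f_nonneg
    by (intro nn_integral_cong) (auto simp: U_minus_eq indicator_def ennreal_mult'[symmetric] not_less antisym)
  also have "\<dots> = (\<integral>\<^sup>+v. ennreal (h v / deficit v) \<partial>de.unit_measure)"
    by (rule de.nn_integral_unit_measure[symmetric]) measurable
  also have "\<dots> = (\<integral>\<^sup>+v. ennreal (h v / deficit v) \<partial>distr ex.unit_measure borel ed.rearrangement)"
    by (simp only: ed.distr_rearrangement)
  also have "\<dots> = (\<integral>\<^sup>+u. ennreal (h (ed.rearrangement u) / deficit (ed.rearrangement u)) \<partial>ex.unit_measure)"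
    by (rule nn_integral_distr[OF m]) measurable
  also have "\<dots> = (\<integral>\<^sup>+u. ennreal (excess u)
      * ennreal (h (ed.rearrangement u) / deficit (ed.rearrangement u)) \<partial>uniform01)"
    by (rule ex.nn_integral_unit_measure) measurable
  also have "\<dots> = (\<integral>\<^sup>+u. ennreal (excess u * (h (ed.rearrangement u) / deficit (ed.rearrangement u))) \<partial>uniform01)"
    using h ex.f_nonneg de.f_nonneg
    by (intro nn_integral_cong ennreal_mult[symmetric] divide_nonneg_nonneg)
  finally show ?thesis .
qed

text \<open>An open half-line is the increasing limit of closed ones.\<close>

lemma dispersion_strict:
  "(\<integral>x. indicator {a<..} x * (x - mean (\<kappa> x)) \<partial>\<mu>) \<le> 0"
proof -
  let ?g = "\<lambda>x. x - mean (\<kappa> x)"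
  have int: "integrable \<mu> ?g"
    using finite_moment_integrable[OF \<mu>_moment] integrable_barycentre by simp
  have "(\<lambda>n. \<integral>x. indicator {a + 1 / real (Suc n)..} x * ?g x \<partial>\<mu>)
      \<longlonglongrightarrow> (\<integral>x. indicator {a<..} x * ?g x \<partial>\<mu>)"
  proof (rule integral_dominated_convergence[where w="\<lambda>x. norm (?g x)"])
    show "AE x in \<mu>. (\<lambda>n. indicator {a + 1 / real (Suc n)..} x * ?g x) \<longlonglongrightarrow> indicator {a<..} x * ?g x"
    proof (intro AE_I2 tendsto_mult tendsto_const)
      fix x
      have "\<forall>\<^sub>F n in sequentially. indicator {a + 1 / real (Suc n)..} x = (indicator {a<..} x :: real)"
      proof (cases "a < x")
        case True
        then obtain N where N: "1 / real (Suc N) < x - a"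
          using nat_approx_posE[of "x - a"] by auto
        have "a + 1 / real (Suc n) \<le> x" if "N \<le> n" for n
        proof -
          have "1 / real (Suc n) \<le> 1 / real (Suc N)"
            using that by (intro divide_left_mono) auto
          with N show ?thesis by linarith
        qed
        with True show ?thesis
          by (auto simp: eventually_sequentially indicator_def)
      next
        case False
        have "\<not> a + 1 / real (Suc n) \<le> x" for n
        proof -
          have "0 < 1 / real (Suc n)" by simp
          with False show ?thesis by linarith
        qed
        with False show ?thesis
          by (simp add: indicator_def)
      qed
      then show "(\<lambda>n. indicator {a + 1 / real (Suc n)..} x) \<longlonglongrightarrow> (indicator {a<..} x :: real)"
        by (rule tendsto_eventually)
    qed
  qed (use int in \<open>auto simp: indicator_def measurable_bary intro!: AE_I2\<close>)
  moreover have "(\<integral>x. indicator {b..} x * ?g x \<partial>\<mu>) \<le> 0" for b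
    using dispersion by (simp add: barycentre_dispersion_def)
  ultimately show ?thesis
    by (intro LIMSEQ_le_const2) auto
qed

text \<open>At a level \<open>w\<close> inside the interval of levels of an atom of \<open>\<mu>\<close> the gap is constant, so the
  tail integral of the gap from \<open>w\<close> is at most the one from the left or the one from the right end
  of that interval; dispersion controls both.\<close>

lemma deficit_le_excess:
  assumes w: "w \<in> {0<..<1}"
  shows "cdf de.unit_measure w \<le> cdf ex.unit_measure w"
proof -
  define a where "a = quantile \<mu> w"
  have tail: "(\<integral>u. indicator S (quantile \<mu> u) * gap u \<partial>uniform01) \<le> 0"
      "integrable uniform01 (\<lambda>u. indicator S (quantile \<mu> u) * gap u)"
    if S: "S = {a..} \<or> S = {a<..}" for S
  proof -
    have [measurable]: "S \<in> sets borel"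
      using S by auto
    have "(\<integral>u. indicator S (quantile \<mu> u) * gap u \<partial>uniform01)
        = (\<integral>x. indicator S x * (x - mean (\<kappa> x)) \<partial>\<mu>)"
      unfolding gap_def bary_def using measurable_bary
      by (intro integral_quantile[of "\<lambda>x. indicator S x * (x - mean (\<kappa> x))"]) measurable
    also have "\<dots> \<le> 0"
      using S dispersion dispersion_strict by (auto simp: barycentre_dispersion_def)
    finally show "(\<integral>u. indicator S (quantile \<mu> u) * gap u \<partial>uniform01) \<le> 0" .
    show "integrable uniform01 (\<lambda>u. indicator S (quantile \<mu> u) * gap u)"
      by (rule Bochner_Integration.integrable_bound[OF integrable_gap])
         (auto simp: indicator_def measurable_restrict_space1)
  qed
  have mono: "quantile \<mu> u \<le> quantile \<mu> v" if "u \<in> {0<..<1}" "v \<in> {0<..<1}" "u \<le> v" for u v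
    using that by (intro \<mu>.quantile_mono) auto
  have gap_cong: "gap u = gap w" if "quantile \<mu> u = a" for u
    using that by (simp add: gap_def bary_def a_def)
  have int_w: "integrable uniform01 (\<lambda>u. indicator {w..} u * gap u)"
    by (rule Bochner_Integration.integrable_bound[OF integrable_gap])
       (auto simp: indicator_def measurable_restrict_space1)
  \<comment> \<open>Adding the levels of the atom before \<open>w\<close> raises the tail integral when the gap is nonnegative;
    otherwise removing those from \<open>w\<close> on raises it.\<close>
  define S where "S = (if 0 \<le> gap w then {a..} else {a<..})"
  have "(\<integral>u. indicator {w..} u * gap u \<partial>uniform01) \<le> (\<integral>u. indicator S (quantile \<mu> u) * gap u \<partial>uniform01)"
  proof (rule integral_mono[OF int_w tail(2)])
    show "S = {a..} \<or> S = {a<..}"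
      by (simp add: S_def)
    fix u assume "u \<in> space uniform01"
    then have u: "u \<in> {0<..<1}"
      by simp
    consider "quantile \<mu> u < a" | "quantile \<mu> u = a" | "a < quantile \<mu> u"
      by linarith
    then show "indicator {w..} u * gap u \<le> indicator S (quantile \<mu> u) * gap u"
    proof cases
      case 1
      then have "u < w"
        using mono[OF w u] by (force simp: a_def)
      with 1 show ?thesis
        by (auto simp: S_def indicator_def)
    next
      case 2
      with gap_cong[OF 2] show ?thesis
        by (auto simp: S_def indicator_def)
    next
      case 3
      then have "w < u"
        using mono[OF u w] by (force simp: a_def)
      with 3 show ?thesis
        by (auto simp: S_def indicator_def)
    qed
  qed
  also have "\<dots> \<le> 0"
    by (rule tail) (simp add: S_def)
  finally have "(\<integral>u. indicator {w..} u * gap u \<partial>uniform01) \<le> 0" .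
  moreover have "(\<integral>u. gap u \<partial>uniform01)
      = (\<integral>u. indicator {w..} u * gap u \<partial>uniform01) + (\<integral>u. indicator {0<..<w} u * gap u \<partial>uniform01)"
  proof (subst Bochner_Integration.integral_add[symmetric])
    show "integrable uniform01 (\<lambda>u. indicator {0<..<w} u * gap u)"
      by (rule Bochner_Integration.integrable_bound[OF integrable_gap])
         (auto simp: indicator_def measurable_restrict_space1)
    show "(\<integral>u. gap u \<partial>uniform01)
        = (\<integral>u. indicator {w..} u * gap u + indicator {0<..<w} u * gap u \<partial>uniform01)"
      by (intro Bochner_Integration.integral_cong) (auto simp: indicator_def)
  qed (rule int_w)
  moreover have "(\<integral>u. indicator {0<..<w} u * gap u \<partial>uniform01) = (LINT u:{0<..<w}|lborel. gap u)"
    unfolding set_integral_uniform01 set_lebesgue_integral_def using w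
    by (intro Bochner_Integration.integral_cong) (auto simp: indicator_def)
  moreover have "(LINT u:{0<..<w}|lborel. gap u)
      = (LINT u:{0<..<w}|lborel. excess u) - (LINT u:{0<..<w}|lborel. deficit u)"
    unfolding gap_eq using w
    by (intro set_integral_diff set_integrable_subset[OF ex.f_integrable] set_integrable_subset[OF de.f_integrable]) auto
  ultimately show ?thesis
    using w integral_gap by (simp add: ex.cdf_unit_measure de.cdf_unit_measure)
qed

text \<open>As \<open>\<phi>(\<phi>(u)) = u\<close>, the level \<open>u\<close> is the smallest \<open>r\<close> with \<open>\<Delta>\<^sub>-(\<phi>(u)) \<le> \<Delta>\<^sub>+(r)\<close>; by dispersion
  \<open>r = \<phi>(u)\<close> satisfies this.\<close>

lemma phi_ge:
  assumes "u \<in> A_plus \<mu> \<kappa>"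
  shows "u \<le> phi \<mu> \<kappa> u"
proof -
  define w where "w = phi \<mu> \<kappa> u"
  have w: "w \<in> U_minus \<mu> \<kappa>" "phi \<mu> \<kappa> w = u"
    using assms by (auto simp: A_plus_eq w_def)
  then have "u = left_inverse (cdf ex.unit_measure) (cdf de.unit_measure w)"
    by (simp add: phi_U_minus de_ex.rearrangement_def)
  also have "\<dots> \<le> w"
    using w(1) deficit_le_excess[of w]
    by (subst ex.left_inverse_le_iff) (auto simp: de_ex.cdf_le_target U_minus_eq)
  finally show ?thesis
    by (simp add: w_def)
qed

end


section \<open>The distributional transform\<close>

context real_distribution
begin

text \<open>The level of a point, an atom being spread uniformly over the interval of levels whose
  quantile it is.\<close>

definition level :: "real \<times> real \<Rightarrow> real" where
  "level p = measure M {..<fst p} + snd p * measure M {fst p}"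

lemma cdf_eq_open_plus_atom: "cdf M x = measure M {..<x} + measure M {x}"
  unfolding cdf_def ivl_disj_un(2)[symmetric] by (subst finite_measure_Union) auto

lemma measure_lessThan_measurable [measurable]: "(\<lambda>x. measure M {..<x}) \<in> borel_measurable borel"
  by (intro borel_measurable_mono monoI finite_measure_mono) auto

lemma cdf_borel_measurable: "cdf M \<in> borel_measurable borel"
  by (intro borel_measurable_mono monoI cdf_nondecreasing)

lemma level_measurable [measurable]: "level \<in> borel_measurable (borel \<Otimes>\<^sub>M borel)"
proof -
  have "(\<lambda>x. measure M {x}) = (\<lambda>x. cdf M x - measure M {..<x})"
    using cdf_eq_open_plus_atom by auto
  moreover have "(\<lambda>x. cdf M x - measure M {..<x}) \<in> borel_measurable borel"
    using cdf_borel_measurable by measurable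
  ultimately have [measurable]: "(\<lambda>x. measure M {x}) \<in> borel_measurable borel"
    by simp
  show ?thesis
    unfolding level_def[abs_def] by measurable
qed

lemma cdf_le_measure_lessThan: "y < x \<Longrightarrow> cdf M y \<le> measure M {..<x}"
  unfolding cdf_def by (intro finite_measure_mono) auto

lemma level_le_cdf: "s \<in> {0<..<1} \<Longrightarrow> level (x, s) \<le> cdf M x"
  by (simp add: level_def cdf_eq_open_plus_atom mult_left_le_one_le)

lemma level_gt_cdf:
  assumes "y < x" "cdf M y < cdf M x" "s \<in> {0<..<1}"
  shows "cdf M y < level (x, s)"
proof (cases "measure M {x} = 0")
  case True
  then show ?thesis
    using assms by (simp add: level_def cdf_eq_open_plus_atom[of x])
next
  case False
  then have "0 < s * measure M {x}"
    using assms by (simp add: zero_less_measure_iff less_le)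
  then show ?thesis
    using cdf_le_measure_lessThan[OF assms(1)] by (simp add: level_def)
qed

text \<open>A quantile of order \<open>v\<close> lying beyond \<open>a\<close> has \<open>F(a) < v\<close>, hence \<open>F(a)\<close> is exceeded
  there.\<close>

lemma cdf_strict_AE: "AE x in M. a < x \<longrightarrow> cdf M a < cdf M x"
proof -
  have pred: "{x \<in> space borel. a < x \<longrightarrow> cdf M a < cdf M x} \<in> sets borel"
    using cdf_borel_measurable by measurable
  have "cdf M a < cdf M (quantile M v)" if v: "v \<in> {0<..<1}" "a < quantile M v" for v
  proof -
    have "cdf M a < v"
      using v quantile_le_iff[of v a] by (simp add: not_le[symmetric])
    also have "v \<le> cdf M (quantile M v)"
      using v quantile_le_iff[of v "quantile M v"] by auto
    finally show ?thesis .
  qed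
  then have "AE v in uniform01. a < quantile M v \<longrightarrow> cdf M a < cdf M (quantile M v)"
    by (intro AE_I2) simp
  then have "AE x in distr uniform01 borel (quantile M). a < x \<longrightarrow> cdf M a < cdf M x"
    using AE_distr_iff[OF measurable_quantile_uniform01 pred] by blast
  then show ?thesis
    by (simp only: distr_quantile)
qed

lemma cdf_strict_left_AE: "AE x in M. \<forall>y<x. cdf M y < cdf M x"
proof -
  have "AE x in M. \<forall>a\<in>\<rat>. a < x \<longrightarrow> cdf M a < cdf M x"
    using cdf_strict_AE by (intro AE_ball_countable[THEN iffD2] countable_rat) auto
  then show ?thesis
  proof eventually_elim
    case (elim x)
    show ?case
    proof (intro allI impI)
      fix y assume "y < x"
      then obtain a where "a \<in> \<rat>" "y < a" "a < x"
        using Rats_dense_in_real by blast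
      then show "cdf M y < cdf M x"
        using elim cdf_nondecreasing[of y a] by fastforce
    qed
  qed
qed

sublocale pair: pair_prob_space M uniform01 ..

lemma measurable_level: "level \<in> M \<Otimes>\<^sub>M uniform01 \<rightarrow>\<^sub>M borel"
proof -
  have "sets (M \<Otimes>\<^sub>M uniform01) = sets (borel \<Otimes>\<^sub>M restrict_space borel {0<..<1::real})"
    by (intro sets_pair_measure_cong sets_restrict_space_cong) auto
  moreover have "level \<in> borel \<Otimes>\<^sub>M restrict_space borel {0<..<1} \<rightarrow>\<^sub>M borel"
  proof -
    have "(\<lambda>p. (fst p, snd p)) \<in> borel \<Otimes>\<^sub>M restrict_space borel {0<..<1::real} \<rightarrow>\<^sub>M borel \<Otimes>\<^sub>M borel"
      by (intro measurable_Pair measurable_fst measurable_compose[OF measurable_snd]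
          measurable_restrict_space1 measurable_ident_sets refl)
    from measurable_compose[OF this level_measurable] show ?thesis
      by simp
  qed
  ultimately show ?thesis
    by (simp cong: measurable_cong_sets)
qed

text \<open>A level \<open>u\<close> is reached from points left of \<open>F\<^sup>-\<^sup>1(u)\<close> always, from points to the right of it almost
  never, and from \<open>a = F\<^sup>-\<^sup>1(u)\<close> itself with the probability that fills the gap between
  \<open>measure M {..<a}\<close> and \<open>u\<close>.\<close>

lemma level_le_emeasure:
  assumes u: "0 < u" "u < 1"
  shows "emeasure (M \<Otimes>\<^sub>M uniform01) {p \<in> space (M \<Otimes>\<^sub>M uniform01). level p \<le> u} = ennreal u"
proof -
  define a where "a = quantile M u"
  have below: "cdf M x < u \<longleftrightarrow> x < a" for x
    using quantile_le_iff[OF u, of x] by (auto simp: a_def not_le[symmetric])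
  have ua: "u \<le> cdf M a"
    using below[of a] by simp
  have au: "measure M {..<a} \<le> u"
  proof (rule tendsto_upperbound[OF cdf_at_left])
    show "\<forall>\<^sub>F x in at_left a. cdf M x \<le> u"
      using below by (intro eventually_at_leftI[of "a - 1"]) (simp_all add: less_imp_le)
  qed simp
  let ?X = "{p \<in> space (M \<Otimes>\<^sub>M uniform01). level p \<le> u}"
  define c where "c = emeasure uniform01 {s \<in> {0<..<1}. level (a, s) \<le> u}"
  have X: "?X \<in> sets (M \<Otimes>\<^sub>M uniform01)"
    using measurable_level by measurable
  have slice: "Pair x -` ?X = {s \<in> {0<..<1}. level (x, s) \<le> u}" for x
    by (auto simp: space_pair_measure)
  have "AE x in M. emeasure uniform01 (Pair x -` ?X) = indicator {..<a} x + c * indicator {a} x"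
    using cdf_strict_AE[of a]
  proof eventually_elim
    case (elim x)
    consider "x < a" | "x = a" | "a < x"
      by linarith
    then show ?case
    proof cases
      case 1
      have "level (x, s) \<le> u" if "s \<in> {0<..<1}" for s
        using level_le_cdf[OF that, of x] below[of x] 1 by simp
      then have "{s \<in> {0<..<1}. level (x, s) \<le> u} = space uniform01"
        by auto
      with 1 show ?thesis
        unfolding slice by (simp only: uniform01.emeasure_space_1) simp
    next
      case 2
      then show ?thesis
        unfolding slice by (simp add: c_def)
    next
      case 3
      have "\<not> level (x, s) \<le> u" if "s \<in> {0<..<1}" for s
        using level_gt_cdf[OF 3 _ that] elim 3 ua by simp
      then have empty: "{s \<in> {0<..<1}. level (x, s) \<le> u} = {}"
        by auto
      show ?thesis
        unfolding slice empty using 3 by simp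
    qed
  qed
  then have "emeasure (M \<Otimes>\<^sub>M uniform01) ?X = (\<integral>\<^sup>+x. indicator {..<a} x + c * indicator {a} x \<partial>M)"
    unfolding uniform01.emeasure_pair_measure_alt[OF X] by (rule nn_integral_cong_AE)
  also have "\<dots> = emeasure M {..<a} + c * emeasure M {a}"
    by (subst nn_integral_add) (auto simp: nn_integral_cmult_indicator)
  also have "\<dots> = ennreal u"
  proof (cases "measure M {a} = 0")
    case True
    then have "measure M {..<a} = u"
      using ua au by (simp add: cdf_eq_open_plus_atom)
    with True show ?thesis
      by (simp add: emeasure_eq_measure)
  next
    case False
    then have pos: "0 < measure M {a}"
      by (simp add: zero_less_measure_iff)
    \<comment> \<open>the fraction of the atom at \<open>a\<close> that lies at levels up to \<open>u\<close>\<close>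
    define d where "d = (u - measure M {..<a}) / measure M {a}"
    have d: "0 \<le> d" "d \<le> 1"
      using au ua pos by (auto simp: d_def cdf_eq_open_plus_atom field_simps)
    have "{s \<in> {0<..<1}. level (a, s) \<le> u} = {0<..d} \<inter> {0<..<1}"
      using pos by (auto simp: level_def d_def field_simps)
    then have "c = ennreal d"
      using emeasure_uniform01_Ioc[of 0 d] d by (simp add: c_def)
    then have "c * emeasure M {a} = ennreal (u - measure M {..<a})"
      using d pos by (simp add: emeasure_eq_measure ennreal_mult'[symmetric]) (simp add: d_def)
    then show ?thesis
      using au by (simp add: emeasure_eq_measure ennreal_plus[symmetric] del: ennreal_plus)
  qed
  finally show ?thesis .
qed

lemma distr_level: "distr (M \<Otimes>\<^sub>M uniform01) borel level = distr uniform01 borel (\<lambda>u. u)"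
proof (rule cdf_unique)
  have id: "(\<lambda>u. u) \<in> uniform01 \<rightarrow>\<^sub>M borel"
    by (intro measurable_restrict_space1) simp
  show rd: "real_distribution (distr (M \<Otimes>\<^sub>M uniform01) borel level)"
    using measurable_level by (rule pair.real_distribution_distr)
  show rd': "real_distribution (distr uniform01 borel (\<lambda>u. u))"
    using id by (rule uniform01.real_distribution_distr)
  have clamp: "cdf N x = max 0 (min 1 x)"
    if N: "real_distribution N" and cdf: "\<And>u. 0 < u \<Longrightarrow> u < 1 \<Longrightarrow> cdf N u = u" for N x
  proof -
    interpret N: real_distribution N by fact
    consider "x \<le> 0" | "0 < x" "x < 1" | "1 \<le> x"
      by linarith
    then show ?thesis
    proof cases
      case 1
      have "cdf N x \<le> 0"
      proof (rule dense_ge)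
        fix e :: real assume "0 < e"
        have "cdf N x \<le> cdf N (min e (1/2))"
          using 1 \<open>0 < e\<close> by (intro N.cdf_nondecreasing) auto
        also have "\<dots> \<le> e"
          using \<open>0 < e\<close> by (subst cdf) auto
        finally show "cdf N x \<le> e" .
      qed
      with 1 N.cdf_nonneg[of x] show ?thesis
        by simp
    next
      case 2
      then show ?thesis
        by (simp add: cdf)
    next
      case 3
      have "1 \<le> cdf N x"
      proof (rule dense_le)
        fix e :: real assume "e < 1"
        have "e \<le> cdf N (max e (1/2))"
          using \<open>e < 1\<close> by (subst cdf) auto
        also have "\<dots> \<le> cdf N x"
          using 3 \<open>e < 1\<close> by (intro N.cdf_nondecreasing) auto
        finally show "e \<le> cdf N x" .
      qed
      with 3 N.cdf_bounded_prob[of x] show ?thesis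
        by simp
    qed
  qed
  have "cdf (distr (M \<Otimes>\<^sub>M uniform01) borel level) u = u" if u: "0 < u" "u < 1" for u
  proof -
    have "emeasure (distr (M \<Otimes>\<^sub>M uniform01) borel level) {..u} = ennreal u"
      using level_le_emeasure[OF u] measurable_level
      by (simp add: emeasure_distr vimage_def Int_def conj_commute)
    then show ?thesis
      using u by (simp add: cdf_def measure_def)
  qed
  moreover have "cdf (distr uniform01 borel (\<lambda>u. u)) u = u" if u: "0 < u" "u < 1" for u
  proof -
    have "{..u} \<inter> {0<..<1} = {0<..u} \<inter> {0<..<1}"
      by auto
    then have "emeasure (distr uniform01 borel (\<lambda>u. u)) {..u} = ennreal u"
      using emeasure_uniform01_Ioc[of 0 u] u id by (simp add: emeasure_distr)
    then show ?thesis
      using u by (simp add: cdf_def measure_def)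
  qed
  ultimately show "cdf (distr (M \<Otimes>\<^sub>M uniform01) borel level) = cdf (distr uniform01 borel (\<lambda>u. u))"
    using clamp[OF rd] clamp[OF rd'] by presburger
qed

lemma AE_level:
  assumes "AE u in uniform01. P u"
  shows "AE p in M \<Otimes>\<^sub>M uniform01. P (level p)"
proof -
  have id: "(\<lambda>u. u) \<in> uniform01 \<rightarrow>\<^sub>M borel"
    by (intro measurable_restrict_space1) simp
  have "AE u in distr uniform01 borel (\<lambda>u. u). u \<in> {0<..<1} \<and> P u"
  proof -
    have "AE u in lborel. u \<in> {0<..<1} \<longrightarrow> P u"
      using assms by (subst (asm) AE_restrict_space_iff) auto
    then obtain N where N: "{u. \<not> (u \<in> {0<..<1} \<longrightarrow> P u)} \<subseteq> N" "N \<in> sets lborel" "emeasure lborel N = 0"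
      by (auto elim!: AE_E)
    show ?thesis
    proof (rule AE_I)
      show "{u \<in> space (distr uniform01 borel (\<lambda>u. u)). \<not> (u \<in> {0<..<1} \<and> P u)} \<subseteq> N \<union> - {0<..<1}"
        using N(1) by auto
      show "emeasure (distr uniform01 borel (\<lambda>u. u)) (N \<union> - {0<..<1}) = 0"
      proof -
        have "(N \<union> - {0<..<1}) \<inter> {0<..<1} = N \<inter> {0<..<1}"
          by auto
        moreover have "emeasure lborel (N \<inter> {0<..<1}) = 0"
          using N emeasure_mono[of "N \<inter> {0<..<1}" N lborel] by auto
        ultimately show ?thesis
          using N id by (simp add: emeasure_distr emeasure_restrict_space)
      qed
      show "N \<union> - {0<..<1} \<in> sets (distr uniform01 borel (\<lambda>u. u))"
        using N by auto
    qed
  qed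
  then have "AE p in M \<Otimes>\<^sub>M uniform01. level p \<in> {0<..<1} \<and> P (level p)"
    unfolding distr_level[symmetric] by (rule AE_distrD[OF measurable_level])
  then show ?thesis
    by eventually_elim simp
qed

text \<open>Almost every \<open>x\<close> has \<open>F(y) < F(x)\<close> for all \<open>y < x\<close>; then \<open>F(y)\<close> also lies below the levels
  of \<open>x\<close>, which in turn do not exceed \<open>F(x)\<close>.\<close>

lemma quantile_level_AE: "AE p in M \<Otimes>\<^sub>M uniform01. quantile M (level p) = fst p"
proof -
  have strict: "AE p in M \<Otimes>\<^sub>M uniform01. \<forall>y<fst p. cdf M y < cdf M (fst p)"
  proof (rule AE_distrD[OF measurable_fst])
    show "AE x in distr (M \<Otimes>\<^sub>M uniform01) M fst. \<forall>y<x. cdf M y < cdf M x"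
      unfolding uniform01.distr_pair_fst by (rule cdf_strict_left_AE)
  qed
  have unit: "AE p in M \<Otimes>\<^sub>M uniform01. level p \<in> {0<..<1}"
    by (rule AE_level) (auto intro: AE_I2)
  have "AE p in M \<Otimes>\<^sub>M uniform01. p \<in> space (M \<Otimes>\<^sub>M uniform01)"
    by (rule AE_space)
  with strict unit show ?thesis
  proof eventually_elim
    case (elim p)
    then obtain x s where p: "p = (x, s)" and s: "s \<in> {0<..<1}"
      by (auto simp: space_pair_measure)
    have le_iff: "quantile M (level p) \<le> y \<longleftrightarrow> level p \<le> cdf M y" for y
      using elim by (intro quantile_le_iff) auto
    have "quantile M (level p) \<le> x"
      unfolding le_iff using level_le_cdf[OF s] by (simp add: p)
    moreover have "\<not> quantile M (level p) < x"
    proof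
      assume lt: "quantile M (level p) < x"
      then have "cdf M (quantile M (level p)) < level p"
        using elim level_gt_cdf[OF lt _ s] by (simp add: p)
      then show False
        using le_iff[of "quantile M (level p)"] by simp
    qed
    ultimately show ?case
      by (simp add: p)
  qed
qed

end


section \<open>The lifted kernel\<close>

lemma finite_moment_in_prob_algebra: "\<eta> \<in> finite_moment 1 \<Longrightarrow> \<eta> \<in> space (prob_algebra borel)"
  using finite_moment_real_distribution
  by (auto simp: space_prob_algebra real_distribution_def real_distribution_axioms_def)

lemma space_finite_moment_algebra: "space finite_moment_algebra = finite_moment 1"
  using finite_moment_in_prob_algebra by (auto simp: finite_moment_algebra_def space_restrict_space)

locale lifted_coupling = dispersed_coupling +
  fixes \<beta> \<beta>'
  assumes maps: "beta_maps \<beta> \<beta>'"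
begin

abbreviation m :: "real \<Rightarrow> real measure" where
  "m \<equiv> lifted_kernel \<beta> \<beta>' \<mu> \<kappa>"

text \<open>The argument of both \<open>\<beta>\<close> and \<open>\<beta>'\<close> for a pair of levels, indexed by its member in \<open>A_plus\<close>.\<close>

definition paired :: "real \<Rightarrow> real \<times> real \<times> real measure \<times> real measure" where
  "paired u = (quantile \<mu> u, quantile \<mu> (phi \<mu> \<kappa> u), \<kappa> (quantile \<mu> u), \<kappa> (quantile \<mu> (phi \<mu> \<kappa> u)))"

lemma A_disjoint: "u \<in> A_plus \<mu> \<kappa> \<Longrightarrow> u \<notin> A_minus \<mu> \<kappa>"
  using U_disjoint by (auto simp: A_plus_eq A_minus_eq)

lemma lifted_A_plus: "u \<in> A_plus \<mu> \<kappa> \<Longrightarrow> m u = \<beta> (paired u)"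
  by (simp add: lifted_kernel_def paired_def Let_def)

lemma lifted_A_minus: "u \<in> A_minus \<mu> \<kappa> \<Longrightarrow> m u = \<beta>' (paired (phi \<mu> \<kappa> u))"
  using A_disjoint[of u] phi_phi(2)[of u] by (auto simp: lifted_kernel_def paired_def Let_def)

lemma lifted_other: "u \<notin> A_plus \<mu> \<kappa> \<Longrightarrow> u \<notin> A_minus \<mu> \<kappa> \<Longrightarrow> m u = \<kappa> (quantile \<mu> u)"
  by (simp add: lifted_kernel_def Let_def)

lemma paired_mem:
  assumes "u \<in> A_plus \<mu> \<kappa>"
  shows "paired u \<in> beta_domain"
proof -
  have u: "u \<in> U_plus \<mu> \<kappa>" "phi \<mu> \<kappa> u \<in> U_minus \<mu> \<kappa>"
    using assms by (auto simp: A_plus_eq)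
  have "quantile \<mu> u \<le> quantile \<mu> (phi \<mu> \<kappa> u)"
    using u phi_ge[OF assms] by (intro \<mu>.quantile_mono) (auto simp: U_plus_def U_minus_def)
  with u show ?thesis
    by (simp add: paired_def beta_domain_def kernel_moment U_plus_def U_minus_def bary_def)
qed

text \<open>The defining properties of \<open>\<beta>\<close> and \<open>\<beta>'\<close>, with the mixture identity divided by the weight \<open>q\<close> of the first
  law, so that the second law carries the Jacobian of \<open>\<phi>\<close>.\<close>

lemma beta_properties:
  assumes u: "u \<in> A_plus \<mu> \<kappa>" and w: "w = phi \<mu> \<kappa> u"
  shows "mean (m u) = quantile \<mu> u" "mean (m w) = quantile \<mu> w"
    "st_le (\<kappa> (quantile \<mu> u)) (m u)" "st_le (m w) (\<kappa> (quantile \<mu> w))"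
    "A \<in> sets borel \<Longrightarrow>
      measure (m u) A + excess u * (measure (m w) A / deficit w)
      = measure (\<kappa> (quantile \<mu> u)) A + excess u * (measure (\<kappa> (quantile \<mu> w)) A / deficit w)"
proof -
  have U: "u \<in> U_plus \<mu> \<kappa>" "w \<in> U_minus \<mu> \<kappa>"
    using u by (auto simp: A_plus_eq w)
  have wA: "w \<in> A_minus \<mu> \<kappa>" and ww: "phi \<mu> \<kappa> w = u"
    using phi_A_plus[OF u] phi_phi(1)[OF u] by (auto simp: w)
  have mu: "m u = \<beta> (paired u)" and mw: "m w = \<beta>' (paired u)"
    using lifted_A_plus[OF u] lifted_A_minus[OF wA] ww by simp_all
  define q where "q = (mean (\<kappa> (quantile \<mu> w)) - quantile \<mu> w)
    / (quantile \<mu> u - mean (\<kappa> (quantile \<mu> u)) + mean (\<kappa> (quantile \<mu> w)) - quantile \<mu> w)"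
  have "\<forall>(y, y', \<eta>, \<eta>')\<in>beta_domain.
        let \<zeta> = \<beta> (y, y', \<eta>, \<eta>');
            \<zeta>' = \<beta>' (y, y', \<eta>, \<eta>');
            q = (mean \<eta>' - y') / (y - mean \<eta> + mean \<eta>' - y')
        in mean \<zeta> = y \<and> mean \<zeta>' = y' \<and> st_le \<eta> \<zeta> \<and> st_le \<zeta>' \<eta>' \<and>
           (\<forall>A\<in>sets borel. q * measure \<zeta> A + (1 - q) * measure \<zeta>' A
                           = q * measure \<eta> A + (1 - q) * measure \<eta>' A)"
    using maps by (simp add: beta_maps_def)
  from bspec[OF this paired_mem[OF u]]
  have props: "mean (m u) = quantile \<mu> u \<and> mean (m w) = quantile \<mu> w
      \<and> st_le (\<kappa> (quantile \<mu> u)) (m u) \<and> st_le (m w) (\<kappa> (quantile \<mu> w))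
      \<and> (\<forall>A\<in>sets borel. q * measure (m u) A + (1 - q) * measure (m w) A
          = q * measure (\<kappa> (quantile \<mu> u)) A + (1 - q) * measure (\<kappa> (quantile \<mu> w)) A)"
    unfolding mu mw by (simp add: paired_def w q_def Let_def)
  then show "mean (m u) = quantile \<mu> u" "mean (m w) = quantile \<mu> w"
    "st_le (\<kappa> (quantile \<mu> u)) (m u)" "st_le (m w) (\<kappa> (quantile \<mu> w))"
    by auto
  define d e where "d = excess u" and "e = deficit w"
  have de: "0 < d" "0 < e"
    using U by (auto simp: d_def e_def U_plus_eq U_minus_eq)
  have q: "q = e / (d + e)" "1 - q = d / (d + e)"
  proof -
    have "d = quantile \<mu> u - mean (\<kappa> (quantile \<mu> u))" "e = mean (\<kappa> (quantile \<mu> w)) - quantile \<mu> w"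
      using U by (auto simp: d_def e_def excess_def deficit_def gap_def bary_def U_plus_def U_minus_def)
    then show "q = e / (d + e)"
      by (simp add: q_def)
    with de show "1 - q = d / (d + e)"
      by (simp add: field_simps)
  qed
  assume A: "A \<in> sets borel"
  have "q * measure (m u) A + (1 - q) * measure (m w) A
      = q * measure (\<kappa> (quantile \<mu> u)) A + (1 - q) * measure (\<kappa> (quantile \<mu> w)) A"
    using props A by blast
  note eq = this[unfolded q(2), unfolded q(1)]
  have "x + d * (y / e) = s / e * (e / s * x + d / s * y)" if "0 < s" for x y s
    using de that by (simp add: field_simps)
  then have weight: "x + d * (y / e) = (d + e) / e * (e / (d + e) * x + d / (d + e) * y)" for x y
    using de by (meson add_pos_pos)
  show "measure (m u) A + excess u * (measure (m w) A / deficit w)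
      = measure (\<kappa> (quantile \<mu> u)) A + excess u * (measure (\<kappa> (quantile \<mu> w)) A / deficit w)"
    unfolding d_def[symmetric] e_def[symmetric] weight eq ..
qed

lemma paired_measurable: "paired \<in> restrict_space borel (A_plus \<mu> \<kappa>) \<rightarrow>\<^sub>M beta_algebra"
  unfolding beta_algebra_def
proof (rule measurable_restrict_space2)
  show "paired \<in> space (restrict_space borel (A_plus \<mu> \<kappa>)) \<rightarrow> beta_domain"
    using paired_mem by (auto simp: space_restrict_space)
  have k: "(\<lambda>u. \<kappa> (quantile \<mu> u)) \<in> borel \<rightarrow>\<^sub>M finite_moment_algebra"
    unfolding finite_moment_algebra_def using kernel_moment
    by (intro measurable_restrict_space2 kernel_quantile_measurable) auto
  have "paired \<in> borel \<rightarrow>\<^sub>M borel \<Otimes>\<^sub>M borel \<Otimes>\<^sub>M finite_moment_algebra \<Otimes>\<^sub>M finite_moment_algebra"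
    unfolding paired_def[abs_def]
    by (intro measurable_Pair quantile_measurable k measurable_compose[OF phi_measurable])
  then show "paired \<in> restrict_space borel (A_plus \<mu> \<kappa>)
      \<rightarrow>\<^sub>M borel \<Otimes>\<^sub>M borel \<Otimes>\<^sub>M finite_moment_algebra \<Otimes>\<^sub>M finite_moment_algebra"
    by (rule measurable_restrict_space1)
qed

lemma lifted_finite_moment: "m u \<in> finite_moment 1"
proof -
  have maps_to: "\<beta> (paired v) \<in> finite_moment 1" "\<beta>' (paired v) \<in> finite_moment 1"
    if "v \<in> A_plus \<mu> \<kappa>" for v
  proof -
    have v: "paired v \<in> space beta_algebra"
      using measurable_space[OF paired_measurable, of v] that by (simp add: space_restrict_space)
    have "\<beta> \<in> beta_algebra \<rightarrow>\<^sub>M finite_moment_algebra" "\<beta>' \<in> beta_algebra \<rightarrow>\<^sub>M finite_moment_algebra"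
      using maps by (simp_all add: beta_maps_def)
    from measurable_space[OF this(1) v] measurable_space[OF this(2) v]
    show "\<beta> (paired v) \<in> finite_moment 1" "\<beta>' (paired v) \<in> finite_moment 1"
      by (simp_all add: space_finite_moment_algebra)
  qed
  consider "u \<in> A_plus \<mu> \<kappa>" | "u \<in> A_minus \<mu> \<kappa>" | "u \<notin> A_plus \<mu> \<kappa>" "u \<notin> A_minus \<mu> \<kappa>"
    by blast
  then show ?thesis
  proof cases
    case 1
    then show ?thesis by (simp add: lifted_A_plus maps_to)
  next
    case 2
    then show ?thesis by (simp add: lifted_A_minus maps_to phi_A_minus)
  next
    case 3
    then show ?thesis by (simp add: lifted_other kernel_moment)
  qed
qed

lemma lifted_measurable: "m \<in> borel \<rightarrow>\<^sub>M prob_algebra borel"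
proof -
  have incl: "(\<lambda>\<eta>. \<eta>) \<in> finite_moment_algebra \<rightarrow>\<^sub>M prob_algebra borel"
    unfolding finite_moment_algebra_def by (intro measurable_restrict_space1 measurable_ident_sets refl)
  have \<beta>: "\<beta> \<in> beta_algebra \<rightarrow>\<^sub>M prob_algebra borel" and \<beta>': "\<beta>' \<in> beta_algebra \<rightarrow>\<^sub>M prob_algebra borel"
    using maps measurable_compose[OF _ incl] by (auto simp: beta_maps_def)
  have plus: "(\<lambda>u. \<beta> (paired u)) \<in> restrict_space borel (A_plus \<mu> \<kappa>) \<rightarrow>\<^sub>M prob_algebra borel"
    by (rule measurable_compose[OF paired_measurable \<beta>])
  have "phi \<mu> \<kappa> \<in> restrict_space borel (A_minus \<mu> \<kappa>) \<rightarrow>\<^sub>M restrict_space borel (A_plus \<mu> \<kappa>)"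
    using phi_A_minus
    by (intro measurable_restrict_space2 measurable_restrict_space1 phi_measurable)
       (auto simp: space_restrict_space)
  then have minus: "(\<lambda>u. \<beta>' (paired (phi \<mu> \<kappa> u))) \<in> restrict_space borel (A_minus \<mu> \<kappa>) \<rightarrow>\<^sub>M prob_algebra borel"
    by (rule measurable_compose[OF measurable_compose[OF _ paired_measurable] \<beta>'])
  have "(\<lambda>u. if u \<in> A_minus \<mu> \<kappa> then \<beta>' (paired (phi \<mu> \<kappa> u)) else \<kappa> (quantile \<mu> u))
      \<in> borel \<rightarrow>\<^sub>M prob_algebra borel"
    using minus kernel_quantile_measurable A_sets(2)
    by (subst measurable_If_restrict_space_iff) (auto intro: measurable_restrict_space1)
  then have "(\<lambda>u. if u \<in> A_plus \<mu> \<kappa> then \<beta> (paired u)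
      else if u \<in> A_minus \<mu> \<kappa> then \<beta>' (paired (phi \<mu> \<kappa> u)) else \<kappa> (quantile \<mu> u))
      \<in> borel \<rightarrow>\<^sub>M prob_algebra borel"
    using plus A_sets(1)
    by (subst measurable_If_restrict_space_iff) (auto intro: measurable_restrict_space1)
  moreover have "m = (\<lambda>u. if u \<in> A_plus \<mu> \<kappa> then \<beta> (paired u)
      else if u \<in> A_minus \<mu> \<kappa> then \<beta>' (paired (phi \<mu> \<kappa> u)) else \<kappa> (quantile \<mu> u))"
    by (auto simp: lifted_A_plus lifted_A_minus lifted_other)
  ultimately show ?thesis
    by simp
qed

lemma lifted_measurable_uniform01: "m \<in> uniform01 \<rightarrow>\<^sub>M prob_algebra borel"
  using measurable_restrict_space1[OF lifted_measurable, of "{0<..<1}"]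
  by (subst measurable_cong_sets[OF sets_restrict_space_cong[OF sets_lborel] refl])

lemma measure_lifted_measurable:
  "A \<in> sets borel \<Longrightarrow> (\<lambda>u. measure (m u) A) \<in> borel_measurable borel"
  by (rule measurable_compose[OF lifted_measurable measurable_measure_prob_algebra])

lemma measure_kernel_quantile_measurable:
  "A \<in> sets borel \<Longrightarrow> (\<lambda>u. measure (\<kappa> (quantile \<mu> u)) A) \<in> borel_measurable borel"
  by (rule measurable_compose[OF kernel_quantile_measurable measurable_measure_prob_algebra])

text \<open>Almost every level is paired or has \<open>F\<^sup>-\<^sup>1(u)\<close> for barycentre, in which case the kernel is kept.\<close>

lemma AE_lifted_cases:
  assumes "\<And>u. u \<in> A_plus \<mu> \<kappa> \<Longrightarrow> P u" "\<And>u. u \<in> A_minus \<mu> \<kappa> \<Longrightarrow> P u"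
    and "\<And>u. u \<in> {0<..<1} \<Longrightarrow> quantile \<mu> u = bary \<mu> \<kappa> u \<Longrightarrow> m u = \<kappa> (quantile \<mu> u) \<Longrightarrow> P u"
  shows "AE u in uniform01. P u"
  using AE_A_plus AE_A_minus AE_space
proof eventually_elim
  case (elim u)
  show ?case
  proof (cases "u \<in> U_plus \<mu> \<kappa> \<or> u \<in> U_minus \<mu> \<kappa>")
    case True
    with elim assms(1,2) show ?thesis by blast
  next
    case False
    then have "m u = \<kappa> (quantile \<mu> u)"
      by (intro lifted_other) (auto simp: A_plus_eq A_minus_eq)
    moreover have "quantile \<mu> u = bary \<mu> \<kappa> u"
      using False elim by (auto simp: U_plus_def U_minus_def)
    ultimately show ?thesis
      using elim assms(3) by simp
  qed
qed

lemma lifted_A_minus_properties: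
  assumes "u \<in> A_minus \<mu> \<kappa>"
  shows "mean (m u) = quantile \<mu> u" "st_le (m u) (\<kappa> (quantile \<mu> u))"
  using beta_properties(2,4)[OF phi_A_minus[OF assms] refl] phi_phi(2)[OF assms] by simp_all

lemma mean_lifted_AE: "AE u in uniform01. mean (m u) = quantile \<mu> u"
  by (rule AE_lifted_cases)
     (simp_all add: beta_properties(1)[OF _ refl] lifted_A_minus_properties bary_def)

lemma cdf_lifted_le_AE:
  "AE u in uniform01. bary \<mu> \<kappa> u \<le> quantile \<mu> u \<longrightarrow> cdf (m u) t \<le> cdf (\<kappa> (quantile \<mu> u)) t"
proof (rule AE_lifted_cases)
  fix u assume "u \<in> A_plus \<mu> \<kappa>"
  then show "bary \<mu> \<kappa> u \<le> quantile \<mu> u \<longrightarrow> cdf (m u) t \<le> cdf (\<kappa> (quantile \<mu> u)) t"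
    by (intro impI st_le_imp_cdf_le finite_moment_real_distribution lifted_finite_moment kernel_moment
        beta_properties(3)) auto
qed (auto simp: A_minus_eq U_minus_def)

lemma cdf_lifted_ge_AE:
  "AE u in uniform01. quantile \<mu> u \<le> bary \<mu> \<kappa> u \<longrightarrow> cdf (\<kappa> (quantile \<mu> u)) t \<le> cdf (m u) t"
proof (rule AE_lifted_cases)
  fix u assume "u \<in> A_minus \<mu> \<kappa>"
  then show "quantile \<mu> u \<le> bary \<mu> \<kappa> u \<longrightarrow> cdf (\<kappa> (quantile \<mu> u)) t \<le> cdf (m u) t"
    by (intro impI st_le_imp_cdf_le finite_moment_real_distribution lifted_finite_moment kernel_moment
        lifted_A_minus_properties)
qed (auto simp: A_plus_eq U_plus_def)

text \<open>Along the pairing of \<open>u\<close> with \<open>\<phi>(u)\<close> the ratio of the densities is the ratio of the weights in the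
  mixture that \<open>\<beta>\<close> and \<open>\<beta>'\<close> preserve, so that the total mass sent to any set is unchanged.\<close>

lemma nn_integral_lifted:
  assumes A: "A \<in> sets borel"
  shows "(\<integral>\<^sup>+u. ennreal (measure (m u) A) \<partial>uniform01)
    = (\<integral>\<^sup>+u. ennreal (measure (\<kappa> (quantile \<mu> u)) A) \<partial>uniform01)"
proof -
  have split: "(\<integral>\<^sup>+u. ennreal (h u) \<partial>uniform01)
      = (\<integral>\<^sup>+u. ennreal (h u) * indicator (- U_minus \<mu> \<kappa>) u
          + ennreal (excess u * (h (ed.rearrangement u) / deficit (ed.rearrangement u))) \<partial>uniform01)"
    if [measurable]: "h \<in> borel_measurable borel" and h: "\<And>u. 0 \<le> h u" for h
  proof -
    have meas: "g \<in> borel_measurable uniform01" if "g \<in> borel_measurable borel" for g :: "real \<Rightarrow> ennreal"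
      using that by (simp add: measurable_restrict_space1)
    have "(\<integral>\<^sup>+u. ennreal (h u) \<partial>uniform01)
        = (\<integral>\<^sup>+u. ennreal (h u) * indicator (- U_minus \<mu> \<kappa>) u
            + ennreal (h u) * indicator (U_minus \<mu> \<kappa>) u \<partial>uniform01)"
      by (intro nn_integral_cong) (auto simp: indicator_def)
    also have "\<dots> = (\<integral>\<^sup>+u. ennreal (h u) * indicator (- U_minus \<mu> \<kappa>) u \<partial>uniform01)
        + (\<integral>\<^sup>+u. ennreal (h u) * indicator (U_minus \<mu> \<kappa>) u \<partial>uniform01)"
      by (rule nn_integral_add; rule meas; measurable)
    also have "\<dots> = (\<integral>\<^sup>+u. ennreal (h u) * indicator (- U_minus \<mu> \<kappa>) u \<partial>uniform01)
        + (\<integral>\<^sup>+u. ennreal (excess u * (h (ed.rearrangement u) / deficit (ed.rearrangement u))) \<partial>uniform01)"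
      by (subst nn_integral_deficit) (auto simp: h)
    also have "\<dots> = (\<integral>\<^sup>+u. ennreal (h u) * indicator (- U_minus \<mu> \<kappa>) u
          + ennreal (excess u * (h (ed.rearrangement u) / deficit (ed.rearrangement u))) \<partial>uniform01)"
      by (rule nn_integral_add[symmetric]; rule meas; measurable)
    finally show ?thesis .
  qed
  have "AE u in uniform01. ennreal (measure (m u) A) * indicator (- U_minus \<mu> \<kappa>) u
        + ennreal (excess u * (measure (m (ed.rearrangement u)) A / deficit (ed.rearrangement u)))
      = ennreal (measure (\<kappa> (quantile \<mu> u)) A) * indicator (- U_minus \<mu> \<kappa>) u
        + ennreal (excess u * (measure (\<kappa> (quantile \<mu> (ed.rearrangement u))) A / deficit (ed.rearrangement u)))"
  proof (rule AE_lifted_cases)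
    fix u assume u: "u \<in> A_plus \<mu> \<kappa>"
    then have U: "u \<in> U_plus \<mu> \<kappa>"
      by (simp add: A_plus_eq)
    have "phi \<mu> \<kappa> u = ed.rearrangement u"
      by (rule phi_U_plus) fact
    from beta_properties(5)[OF u this[symmetric] A]
    show "ennreal (measure (m u) A) * indicator (- U_minus \<mu> \<kappa>) u
        + ennreal (excess u * (measure (m (ed.rearrangement u)) A / deficit (ed.rearrangement u)))
      = ennreal (measure (\<kappa> (quantile \<mu> u)) A) * indicator (- U_minus \<mu> \<kappa>) u
        + ennreal (excess u * (measure (\<kappa> (quantile \<mu> (ed.rearrangement u))) A / deficit (ed.rearrangement u)))"
      using U_disjoint[OF U] ex.f_nonneg de.f_nonneg
      by (simp add: ennreal_plus[symmetric] del: ennreal_plus)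
  next
    fix u assume "u \<in> A_minus \<mu> \<kappa>"
    then have "u \<in> U_minus \<mu> \<kappa>" "excess u = 0"
      by (auto simp: A_minus_eq U_minus_def excess_def gap_def)
    then show "ennreal (measure (m u) A) * indicator (- U_minus \<mu> \<kappa>) u
        + ennreal (excess u * (measure (m (ed.rearrangement u)) A / deficit (ed.rearrangement u)))
      = ennreal (measure (\<kappa> (quantile \<mu> u)) A) * indicator (- U_minus \<mu> \<kappa>) u
        + ennreal (excess u * (measure (\<kappa> (quantile \<mu> (ed.rearrangement u))) A / deficit (ed.rearrangement u)))"
      by simp
  next
    fix u assume "quantile \<mu> u = bary \<mu> \<kappa> u" "m u = \<kappa> (quantile \<mu> u)"
    then show "ennreal (measure (m u) A) * indicator (- U_minus \<mu> \<kappa>) u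
        + ennreal (excess u * (measure (m (ed.rearrangement u)) A / deficit (ed.rearrangement u)))
      = ennreal (measure (\<kappa> (quantile \<mu> u)) A) * indicator (- U_minus \<mu> \<kappa>) u
        + ennreal (excess u * (measure (\<kappa> (quantile \<mu> (ed.rearrangement u))) A / deficit (ed.rearrangement u)))"
      by (simp add: excess_def gap_def)
  qed
  then show ?thesis
    unfolding split[OF measure_lifted_measurable[OF A] measure_nonneg]
      split[OF measure_kernel_quantile_measurable[OF A] measure_nonneg]
    by (rule nn_integral_cong_AE)
qed

end


section \<open>The rearranged coupling\<close>

context lifted_coupling
begin

interpretation lift: real_kernel uniform01 "quantile \<mu>" m
  using lifted_measurable_uniform01 \<mu>.measurable_quantile_uniform01 by unfold_locales

lemma bind_lifted: "bind uniform01 m = \<nu>"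
proof (rule measure_eqI)
  have \<mu>_mem: "\<mu> \<in> space (prob_algebra \<mu>)"
    by (rule N_in_prob_algebra)
  show "sets (bind uniform01 m) = sets \<nu>"
    using sets_bind'[OF lift.N_in_prob_algebra lifted_measurable_uniform01] by simp
  fix B assume "B \<in> sets (bind uniform01 m)"
  then have B: "B \<in> sets borel"
    using sets_bind'[OF lift.N_in_prob_algebra lifted_measurable_uniform01] by simp
  have em: "emeasure \<eta> B = ennreal (measure \<eta> B)" if "\<eta> \<in> finite_moment 1" for \<eta>
  proof -
    interpret \<eta>: real_distribution \<eta>
      by (rule finite_moment_real_distribution) fact
    show ?thesis by (rule \<eta>.emeasure_eq_measure)
  qed
  have k: "(\<lambda>x. ennreal (measure (\<kappa> x) B)) \<in> borel_measurable borel"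
    using measurable_compose[OF kernel_measurable measurable_measure_prob_algebra[OF B]] by measurable
  have "emeasure (bind uniform01 m) B = (\<integral>\<^sup>+u. ennreal (measure (m u) B) \<partial>uniform01)"
    by (simp add: emeasure_bind_prob_algebra[OF lift.N_in_prob_algebra lifted_measurable_uniform01 B]
        em lifted_finite_moment)
  also have "\<dots> = (\<integral>\<^sup>+u. ennreal (measure (\<kappa> (quantile \<mu> u)) B) \<partial>uniform01)"
    by (rule nn_integral_lifted) fact
  also have "\<dots> = (\<integral>\<^sup>+x. ennreal (measure (\<kappa> x) B) \<partial>\<mu>)"
    by (rule nn_integral_quantile[OF k])
  also have "\<dots> = emeasure (bind \<mu> \<kappa>) B"
    by (simp add: emeasure_bind_prob_algebra[OF \<mu>_mem k_measurable B] em kernel_moment)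
  finally show "emeasure (bind uniform01 m) B = emeasure \<nu> B"
    by (simp only: second_marginal_eq[symmetric])
qed

lemma rearranged_eq: "rearranged \<mu> m = semidirect uniform01 (quantile \<mu>) m"
  by (simp add: rearranged_def semidirect_def)

lemma rearranged_coupling: "rearranged \<mu> m \<in> couplings \<mu> \<nu>"
  unfolding couplings_def rearranged_eq
  using lift.prob_space_semidirect lift.sets_semidirect lift.distr_fst_semidirect
    lift.distr_snd_semidirect bind_lifted \<mu>.distr_quantile by simp

lemma measure_rearranged_Times:
  assumes "A \<in> sets borel" "B \<in> sets borel"
  shows "measure (rearranged \<mu> m) (A \<times> B) = (\<integral>u. indicator A (quantile \<mu> u) * measure (m u) B \<partial>uniform01)"
  unfolding rearranged_eq by (rule lift.measure_semidirect_Times) fact+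

text \<open>The conditional law of the second coordinate given the first: the average of \<open>m\<close> over the
  levels of a point.\<close>

definition level_average :: "real \<Rightarrow> real measure" where
  "level_average x = bind uniform01 (\<lambda>s. m (\<mu>.level (x, s)))"

lemma level_kernel_measurable:
  "(\<lambda>p. m (\<mu>.level p)) \<in> borel \<Otimes>\<^sub>M uniform01 \<rightarrow>\<^sub>M prob_algebra borel"
proof -
  have "\<mu>.level \<in> borel \<Otimes>\<^sub>M uniform01 \<rightarrow>\<^sub>M borel"
    using \<mu>.measurable_level
    by (subst (asm) measurable_cong_sets[OF sets_pair_measure_cong[OF \<mu>.events_eq_borel refl] refl])
  then show ?thesis
    by (rule measurable_compose[OF _ lifted_measurable])
qed

lemma level_kernel_section_measurable:
  "(\<lambda>s. m (\<mu>.level (x, s))) \<in> uniform01 \<rightarrow>\<^sub>M prob_algebra borel"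
  by (rule measurable_compose[OF measurable_Pair1' level_kernel_measurable]) simp

lemma level_average_measurable: "level_average \<in> borel \<rightarrow>\<^sub>M prob_algebra borel"
  unfolding level_average_def[abs_def]
proof (rule measurable_bind_prob_space2)
  show "(\<lambda>x. uniform01) \<in> borel \<rightarrow>\<^sub>M prob_algebra uniform01"
    using lift.N_in_prob_algebra by (rule measurable_const)
  show "(\<lambda>(x, s). m (\<mu>.level (x, s))) \<in> borel \<Otimes>\<^sub>M uniform01 \<rightarrow>\<^sub>M prob_algebra borel"
    using level_kernel_measurable by (simp add: split_beta)
qed

text \<open>The distributional transform sends \<open>\<mu> \<otimes> uniform01\<close> to \<open>uniform01\<close> and is undone by the quantile
  function, so a set of points may be tested on levels.\<close>

lemma integral_level_average:
  assumes [measurable]: "A \<in> sets borel" "B \<in> sets borel"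
  shows "(\<integral>x. indicator A x * measure (level_average x) B \<partial>\<mu>) = measure (rearranged \<mu> m) (A \<times> B)"
proof -
  let ?h = "\<lambda>u. indicator A (quantile \<mu> u) * measure (m u) B"
  let ?f = "\<lambda>p. indicator A (fst p) * measure (m (\<mu>.level p)) B"
  have mB: "(\<lambda>u. measure (m u) B) \<in> borel_measurable borel"
    by (rule measure_lifted_measurable) fact
  have h: "?h \<in> borel_measurable borel"
    using mB \<mu>.measurable_quantile by measurable
  have le1: "measure (m u) B \<le> 1" for u
    using finite_moment_real_distribution[OF lifted_finite_moment[of u]]
    by (auto simp: real_distribution_def intro: prob_space.prob_le_1)
  have f: "?f \<in> borel_measurable (\<mu> \<Otimes>\<^sub>M uniform01)"
  proof (intro borel_measurable_times)
    have "fst \<in> \<mu> \<Otimes>\<^sub>M uniform01 \<rightarrow>\<^sub>M borel"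
      using measurable_fst[of \<mu> uniform01] by (simp cong: measurable_cong_sets)
    from measurable_compose[OF this borel_measurable_indicator[OF assms(1)]]
    show "(\<lambda>p. indicator A (fst p)) \<in> borel_measurable (\<mu> \<Otimes>\<^sub>M uniform01)" .
    show "(\<lambda>p. measure (m (\<mu>.level p)) B) \<in> borel_measurable (\<mu> \<Otimes>\<^sub>M uniform01)"
      by (rule measurable_compose[OF \<mu>.measurable_level mB])
  qed
  have fint: "integrable (\<mu> \<Otimes>\<^sub>M uniform01) ?f"
    using f le1 by (intro \<mu>.pair.integrable_const_bound[where B=1] AE_I2) (auto simp: indicator_def)
  have "(\<integral>x. indicator A x * measure (level_average x) B \<partial>\<mu>) = (\<integral>x. (\<integral>s. ?f (x, s) \<partial>uniform01) \<partial>\<mu>)"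
    unfolding level_average_def
    by (simp add: uniform01.measure_bind[OF measurable_prob_algebraD[OF level_kernel_section_measurable] assms(2)])
  also have "\<dots> = (\<integral>p. ?f p \<partial>(\<mu> \<Otimes>\<^sub>M uniform01))"
    by (rule \<mu>.pair.integral_fst'[OF fint])
  also have "\<dots> = (\<integral>p. ?h (\<mu>.level p) \<partial>(\<mu> \<Otimes>\<^sub>M uniform01))"
  proof (rule integral_cong_AE[OF f])
    show "(\<lambda>p. ?h (\<mu>.level p)) \<in> borel_measurable (\<mu> \<Otimes>\<^sub>M uniform01)"
      by (rule measurable_compose[OF \<mu>.measurable_level h])
    show "AE p in \<mu> \<Otimes>\<^sub>M uniform01. ?f p = ?h (\<mu>.level p)"
      using \<mu>.quantile_level_AE by eventually_elim simp
  qed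
  also have "\<dots> = (\<integral>u. ?h u \<partial>distr (\<mu> \<Otimes>\<^sub>M uniform01) borel \<mu>.level)"
    by (rule integral_distr[OF \<mu>.measurable_level h, symmetric])
  also have "\<dots> = (\<integral>u. ?h u \<partial>distr uniform01 borel (\<lambda>u. u))"
    by (simp only: \<mu>.distr_level)
  also have "\<dots> = (\<integral>u. ?h u \<partial>uniform01)"
    by (rule integral_distr[OF _ h]) (intro measurable_restrict_space1, simp)
  finally show ?thesis
    by (simp add: measure_rearranged_Times)
qed

lemma level_average_distribution: "real_distribution (level_average x)"
  by (rule kernel_real_distribution[OF level_average_measurable]) simp

lemma bind_level_average: "bind \<mu> level_average = \<nu>"
proof -
  have k: "level_average \<in> \<mu> \<rightarrow>\<^sub>M prob_algebra borel"
    using level_average_measurable by (simp cong: measurable_cong_sets)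
  interpret avg: real_kernel \<mu> "\<lambda>x. x" level_average
    using f_measurable k by unfold_locales
  have "semidirect \<mu> (\<lambda>x. x) level_average = rearranged \<mu> m"
    by (rule prob_measure_eqI_Times)
       (simp_all add: avg.prob_space_semidirect avg.sets_semidirect avg.measure_semidirect_Times
         integral_level_average couplingsD(1,2)[OF rearranged_coupling])
  then show ?thesis
    using avg.distr_snd_semidirect couplingsD(4)[OF rearranged_coupling] by simp
qed

lemma level_average_moment_AE: "AE x in \<mu>. level_average x \<in> finite_moment 1"
proof -
  have k: "level_average \<in> \<mu> \<rightarrow>\<^sub>M prob_algebra borel"
    using level_average_measurable by (simp cong: measurable_cong_sets)
  have "AE x in \<mu>. integrable (level_average x) (\<lambda>y. y)"
    using mean_bind(1)[OF \<mu>.prob_space_axioms k] \<nu>_moment by (simp add: bind_level_average)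
  then show ?thesis
    by eventually_elim (simp add: finite_moment_one_iff level_average_distribution)
qed

text \<open>On a null set the average over the levels may lack a first moment; any fixed law with a first moment
  serves there.\<close>

definition conditional :: "real \<Rightarrow> real measure" where
  "conditional x = (if level_average x \<in> finite_moment 1 then level_average x else \<mu>)"

lemma conditional_AE: "AE x in \<mu>. conditional x = level_average x"
  using level_average_moment_AE by eventually_elim (simp add: conditional_def)

lemma conditional_moment: "conditional x \<in> finite_moment 1"
  by (simp add: conditional_def \<mu>_moment)

lemma conditional_measurable: "conditional \<in> borel \<rightarrow>\<^sub>M prob_algebra borel"
proof -
  have "Measurable.pred (subprob_algebra borel) (\<lambda>\<eta>. integrable \<eta> (\<lambda>y::real. y))"
    by (rule integrable_measurable_subprob_algebra) simp
  then have "Measurable.pred borel (\<lambda>x. integrable (level_average x) (\<lambda>y. y))"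
    by (rule measurable_compose[OF measurable_prob_algebraD[OF level_average_measurable]])
  then have "Measurable.pred borel (\<lambda>x. level_average x \<in> finite_moment 1)"
    by (simp add: finite_moment_one_iff level_average_distribution)
  moreover have "(\<lambda>x. \<mu>) \<in> borel \<rightarrow>\<^sub>M prob_algebra borel"
    by (rule measurable_const) (rule finite_moment_in_prob_algebra[OF \<mu>_moment])
  ultimately show ?thesis
    unfolding conditional_def[abs_def] using level_average_measurable
    by (intro measurable_If) (simp_all add: pred_def)
qed

lemma disintegration_rearranged: "disintegration (rearranged \<mu> m) conditional"
proof -
  have k: "conditional \<in> \<mu> \<rightarrow>\<^sub>M prob_algebra borel"
    using conditional_measurable by (simp cong: measurable_cong_sets)
  interpret cond: real_kernel \<mu> "\<lambda>x. x" conditional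
    using f_measurable k by unfold_locales
  have "rearranged \<mu> m = semidirect \<mu> (\<lambda>x. x) conditional"
  proof (rule prob_measure_eqI_Times)
    fix A B :: "real set" assume AB: "A \<in> sets borel" "B \<in> sets borel"
    have meas: "(\<lambda>x. indicator A x * measure (K x) B) \<in> borel_measurable \<mu>"
      if "K \<in> borel \<rightarrow>\<^sub>M prob_algebra borel" for K
      using measurable_compose[OF that measurable_measure_prob_algebra[OF AB(2)]] AB
      by (intro borel_measurable_times) (simp_all add: \<mu>.measurable_finite_borel)
    have "measure (rearranged \<mu> m) (A \<times> B) = (\<integral>x. indicator A x * measure (level_average x) B \<partial>\<mu>)"
      by (rule integral_level_average[OF AB, symmetric])
    also have "\<dots> = (\<integral>x. indicator A x * measure (conditional x) B \<partial>\<mu>)"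
      using conditional_AE
      by (intro integral_cong_AE meas level_average_measurable conditional_measurable)
         (auto elim!: eventually_mono)
    also have "\<dots> = measure (semidirect \<mu> (\<lambda>x. x) conditional) (A \<times> B)"
      by (rule cond.measure_semidirect_Times[OF AB, symmetric])
    finally show "measure (rearranged \<mu> m) (A \<times> B) = measure (semidirect \<mu> (\<lambda>x. x) conditional) (A \<times> B)" .
  qed (fact couplingsD[OF rearranged_coupling] cond.prob_space_semidirect cond.sets_semidirect)+
  then show ?thesis
    using conditional_measurable conditional_moment couplingsD(3)[OF rearranged_coupling]
    by (simp add: disintegration_def semidirect_def)
qed

text \<open>At almost every \<open>x\<close>, almost all levels \<open>u\<close> of \<open>x\<close> satisfy \<open>mean (m u) = F\<^sup>-\<^sup>1(u) = x\<close>.\<close>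

lemma mean_conditional_AE: "AE x in \<mu>. mean (conditional x) = x"
proof -
  have "AE p in \<mu> \<Otimes>\<^sub>M uniform01. mean (m (\<mu>.level p)) = fst p"
    using \<mu>.AE_level[OF mean_lifted_AE] \<mu>.quantile_level_AE by eventually_elim simp
  then have "AE x in \<mu>. AE s in uniform01. mean (m (\<mu>.level (x, s))) = x"
    using \<mu>.pair.AE_pair[of "\<lambda>p. mean (m (\<mu>.level p)) = fst p"] by simp
  with level_average_moment_AE show ?thesis
  proof eventually_elim
    case (elim x)
    note k = level_kernel_section_measurable[of x]
    have "mean (level_average x) = (\<integral>s. mean (m (\<mu>.level (x, s))) \<partial>uniform01)"
      using mean_bind(3)[OF prob_space_uniform01 k] elim(1) by (simp add: level_average_def)
    also have "\<dots> = (\<integral>s. x \<partial>uniform01)"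
      using elim(2) measurable_mean_kernel[OF k] by (intro integral_cong_AE) auto
    also have "\<dots> = x"
      using uniform01.prob_space by simp
    finally show ?case
      using elim(1) by (simp add: conditional_def)
  qed
qed

lemma rearranged_martingale: "rearranged \<mu> m \<in> martingale_couplings \<mu> \<nu>"
  unfolding martingale_couplings_def
  using rearranged_coupling disintegration_rearranged mean_conditional_AE by blast

text \<open>Above its barycentre a point only receives kernels that dominate \<open>\<kappa>\<^sub>x\<close>, below it only
  kernels that \<open>\<kappa>\<^sub>x\<close> dominates; in both cases the comonotone coupling realises the difference of
  the means.\<close>

lemma wasserstein_rearranged_AE:
  assumes K: "disintegration (rearranged \<mu> m) K"
  shows "AE x in \<mu>. wasserstein 1 (\<kappa> x) (K x) = ennreal \<bar>mean (\<kappa> x) - x\<bar>"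
proof -
  interpret K: disintegrated_coupling \<mu> \<nu> "rearranged \<mu> m" K
    using rearranged_coupling K by unfold_locales
  interpret C: disintegrated_coupling \<mu> \<nu> "rearranged \<mu> m" conditional
    using rearranged_coupling disintegration_rearranged by unfold_locales
  have mean: "AE x in \<mu>. mean (K x) = x"
    using C.kernel_unique_AE[OF K] mean_conditional_AE by eventually_elim simp
  have via_quantile: "(\<integral>x. indicator A x * measure (\<kappa> x) {..t} \<partial>\<mu>)
      = (\<integral>u. indicator A (quantile \<mu> u) * measure (\<kappa> (quantile \<mu> u)) {..t} \<partial>uniform01)"
    "integrable uniform01 (\<lambda>u. indicator A (quantile \<mu> u) * measure (\<kappa> (quantile \<mu> u)) {..t})"
    if A: "A \<in> sets borel" for A t
  proof -
    have "(\<lambda>x. measure (\<kappa> x) {..t}) \<in> borel_measurable borel"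
      by (rule measurable_compose[OF kernel_measurable measurable_measure_prob_algebra]) simp
    then have g: "(\<lambda>x. indicator A x * measure (\<kappa> x) {..t}) \<in> borel_measurable borel"
      using A by (intro borel_measurable_times borel_measurable_indicator)
    show "(\<integral>x. indicator A x * measure (\<kappa> x) {..t} \<partial>\<mu>)
      = (\<integral>u. indicator A (quantile \<mu> u) * measure (\<kappa> (quantile \<mu> u)) {..t} \<partial>uniform01)"
      by (rule integral_quantile[OF g, symmetric])
    show "integrable uniform01 (\<lambda>u. indicator A (quantile \<mu> u) * measure (\<kappa> (quantile \<mu> u)) {..t})"
      by (rule integrable_quantile[OF integrable_indicator_kernel]) (use A in auto)
  qed
  have lift_int: "integrable uniform01 (\<lambda>u. indicator A (quantile \<mu> u) * measure (m u) {..t})"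
    if "A \<in> sets borel" for A t
    by (rule lift.integrable_indicator_kernel) (use that in auto)
  have above: "AE x in \<mu>. x \<in> {x. mean (\<kappa> x) \<le> x} \<longrightarrow> (\<forall>t. cdf (K x) t \<le> cdf (\<kappa> x) t)"
  proof (rule kernel_cdf_le_AE[OF \<mu>.real_distribution_axioms K.kernel_measurable kernel_measurable])
    show "{x. mean (\<kappa> x) \<le> x} \<in> sets borel"
      using measurable_bary by measurable
    fix A t assume A: "A \<in> sets borel" "A \<subseteq> {x. mean (\<kappa> x) \<le> x}"
    have "AE u in uniform01. indicator A (quantile \<mu> u) * measure (m u) {..t}
        \<le> indicator A (quantile \<mu> u) * measure (\<kappa> (quantile \<mu> u)) {..t}"
      using cdf_lifted_le_AE[of t]
      by eventually_elim (use A(2) in \<open>auto simp: indicator_def bary_def cdf_def\<close>)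
    then have "(\<integral>u. indicator A (quantile \<mu> u) * measure (m u) {..t} \<partial>uniform01)
        \<le> (\<integral>u. indicator A (quantile \<mu> u) * measure (\<kappa> (quantile \<mu> u)) {..t} \<partial>uniform01)"
      by (rule integral_mono_AE[OF lift_int[OF A(1)] via_quantile(2)[OF A(1)]])
    then show "(\<integral>x. indicator A x * measure (K x) {..t} \<partial>\<mu>) \<le> (\<integral>x. indicator A x * measure (\<kappa> x) {..t} \<partial>\<mu>)"
      using A(1) by (simp add: K.measure_Times[symmetric] measure_rearranged_Times via_quantile(1))
  qed
  have below: "AE x in \<mu>. x \<in> {x. x \<le> mean (\<kappa> x)} \<longrightarrow> (\<forall>t. cdf (\<kappa> x) t \<le> cdf (K x) t)"
  proof (rule kernel_cdf_le_AE[OF \<mu>.real_distribution_axioms kernel_measurable K.kernel_measurable])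
    show "{x. x \<le> mean (\<kappa> x)} \<in> sets borel"
      using measurable_bary by measurable
    fix A t assume A: "A \<in> sets borel" "A \<subseteq> {x. x \<le> mean (\<kappa> x)}"
    have "AE u in uniform01. indicator A (quantile \<mu> u) * measure (\<kappa> (quantile \<mu> u)) {..t}
        \<le> indicator A (quantile \<mu> u) * measure (m u) {..t}"
      using cdf_lifted_ge_AE[of t]
      by eventually_elim (use A(2) in \<open>auto simp: indicator_def bary_def cdf_def\<close>)
    then have "(\<integral>u. indicator A (quantile \<mu> u) * measure (\<kappa> (quantile \<mu> u)) {..t} \<partial>uniform01)
        \<le> (\<integral>u. indicator A (quantile \<mu> u) * measure (m u) {..t} \<partial>uniform01)"
      by (rule integral_mono_AE[OF via_quantile(2)[OF A(1)] lift_int[OF A(1)]])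
    then show "(\<integral>x. indicator A x * measure (\<kappa> x) {..t} \<partial>\<mu>) \<le> (\<integral>x. indicator A x * measure (K x) {..t} \<partial>\<mu>)"
      using A(1) by (simp add: K.measure_Times[symmetric] measure_rearranged_Times via_quantile(1))
  qed
  show ?thesis
    using mean above below
  proof eventually_elim
    case (elim x)
    have "wasserstein 1 (\<kappa> x) (K x) \<le> ennreal \<bar>mean (\<kappa> x) - x\<bar>"
    proof (cases "mean (\<kappa> x) \<le> x")
      case True
      with elim have "wasserstein 1 (\<kappa> x) (K x) \<le> ennreal (mean (K x) - mean (\<kappa> x))"
        by (intro wasserstein_le_mean_diff(1) kernel_moment K.kernel_moment) auto
      with True elim(1) show ?thesis by simp
    next
      case False
      with elim have "wasserstein 1 (\<kappa> x) (K x) \<le> ennreal (mean (\<kappa> x) - mean (K x))"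
        by (intro wasserstein_le_mean_diff(2) kernel_moment K.kernel_moment) auto
      with False elim(1) show ?thesis by simp
    qed
    moreover have "ennreal \<bar>mean (\<kappa> x) - mean (K x)\<bar> \<le> wasserstein 1 (\<kappa> x) (K x)"
      by (intro wasserstein_ge_mean_diff kernel_moment K.kernel_moment)
    ultimately show ?case
      using elim(1) by simp
  qed
qed

lemma adapted_wasserstein_rearranged:
  "adapted_wasserstein 1 \<pi> (rearranged \<mu> m) = (\<integral>\<^sup>+x. ennreal \<bar>mean (\<kappa> x) - x\<bar> \<partial>\<mu>)"
proof (rule antisym)
  interpret C: disintegrated_coupling \<mu> \<nu> "rearranged \<mu> m" conditional
    using rearranged_coupling disintegration_rearranged by unfold_locales
  have "adapted_wasserstein 1 \<pi> (rearranged \<mu> m)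
      \<le> (\<integral>\<^sup>+x. wasserstein 1 (kernel_of \<pi> x) (kernel_of (rearranged \<mu> m) x) \<partial>\<mu>)"
    by (rule adapted_wasserstein_le_diagonal[OF coupling rearranged_coupling])
  also have "\<dots> = (\<integral>\<^sup>+x. ennreal \<bar>mean (\<kappa> x) - x\<bar> \<partial>\<mu>)"
    using kernel_unique_AE[OF disintegration_kernel_of]
      wasserstein_rearranged_AE[OF C.disintegration_kernel_of]
    by (intro nn_integral_cong_AE) (auto elim: eventually_elim2)
  finally show "adapted_wasserstein 1 \<pi> (rearranged \<mu> m) \<le> (\<integral>\<^sup>+x. ennreal \<bar>mean (\<kappa> x) - x\<bar> \<partial>\<mu>)" .
  show "(\<integral>\<^sup>+x. ennreal \<bar>mean (\<kappa> x) - x\<bar> \<partial>\<mu>) \<le> adapted_wasserstein 1 \<pi> (rearranged \<mu> m)"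
    by (rule adapted_wasserstein_martingale_ge[OF rearranged_martingale])
qed

end

lemma convex_order_mean_eq:
  assumes "\<mu> \<in> finite_moment 1" "\<nu> \<in> finite_moment 1" "convex_order \<mu> \<nu>"
  shows "mean \<mu> = mean \<nu>"
proof -
  have ord: "(\<integral>x. f x \<partial>\<mu>) \<le> (\<integral>x. f x \<partial>\<nu>)" if "convex_on UNIV f" "integrable \<nu> f" for f
    using assms(3) that by (simp add: convex_order_def)
  have "convex_on UNIV (\<lambda>x::real. x)" "convex_on UNIV (\<lambda>x::real. - x)"
    by (auto simp: convex_on_def algebra_simps)
  from ord[OF this(1)] ord[OF this(2)] show ?thesis
    using finite_moment_integrable[OF assms(2)] by (simp add: mean_def)
qed

theorem corollary2p6:
  fixes \<mu> \<nu> :: "real measure"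
    and \<pi> M :: "(real \<times> real) measure"
    and \<kappa> m :: "real \<Rightarrow> real measure"
    and \<beta> \<beta>' :: "real \<times> real \<times> real measure \<times> real measure \<Rightarrow> real measure"
  assumes "\<mu> \<in> finite_moment 1" and "\<nu> \<in> finite_moment 1"
    and "convex_order \<mu> \<nu>" and "\<mu> \<noteq> \<nu>"
    and "\<pi> \<in> couplings \<mu> \<nu>" and "disintegration \<pi> \<kappa>"
    and "barycentre_dispersion \<mu> \<kappa>"
    and "beta_maps \<beta> \<beta>'"
  defines "m \<equiv> lifted_kernel \<beta> \<beta>' \<mu> \<kappa>"
  defines "M \<equiv> rearranged \<mu> m"
  shows "martingale_rearrangement \<mu> \<nu> \<pi> M \<and>
    M \<in> martingale_couplings \<mu> \<nu> \<and>
    (INF M'\<in>martingale_couplings \<mu> \<nu>. adapted_wasserstein 1 \<pi> M') = adapted_wasserstein 1 \<pi> M \<and>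
    (\<forall>K. disintegration M K \<longrightarrow>
       adapted_wasserstein 1 \<pi> M = (\<integral>\<^sup>+ x. wasserstein 1 (\<kappa> x) (K x) \<partial>\<mu>)) \<and>
    adapted_wasserstein 1 \<pi> M = (\<integral>\<^sup>+ x. ennreal \<bar>mean (\<kappa> x) - x\<bar> \<partial>\<mu>)"
proof -
  interpret lifted_coupling \<mu> \<nu> \<pi> \<kappa> \<beta> \<beta>'
    using assms(1,2,5-8) convex_order_mean_eq[OF assms(1-3)] by unfold_locales
  have mart: "M \<in> martingale_couplings \<mu> \<nu>"
    and AW: "adapted_wasserstein 1 \<pi> M = (\<integral>\<^sup>+ x. ennreal \<bar>mean (\<kappa> x) - x\<bar> \<partial>\<mu>)"
    unfolding M_def m_def by (rule rearranged_martingale, rule adapted_wasserstein_rearranged)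
  have inf: "(INF M'\<in>martingale_couplings \<mu> \<nu>. adapted_wasserstein 1 \<pi> M') = adapted_wasserstein 1 \<pi> M"
  proof (rule antisym)
    show "(INF M'\<in>martingale_couplings \<mu> \<nu>. adapted_wasserstein 1 \<pi> M') \<le> adapted_wasserstein 1 \<pi> M"
      using mart by (rule INF_lower)
    show "adapted_wasserstein 1 \<pi> M \<le> (INF M'\<in>martingale_couplings \<mu> \<nu>. adapted_wasserstein 1 \<pi> M')"
      unfolding AW by (rule INF_greatest) (rule adapted_wasserstein_martingale_ge)
  qed
  have "adapted_wasserstein 1 \<pi> M = (\<integral>\<^sup>+ x. wasserstein 1 (\<kappa> x) (K x) \<partial>\<mu>)"
    if "disintegration M K" for K
    unfolding AW using wasserstein_rearranged_AE[of K] that unfolding M_def m_def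
    by (intro nn_integral_cong_AE) (auto elim!: eventually_mono)
  with mart AW inf show ?thesis
    by (simp add: martingale_rearrangement_def)
qed

end
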